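(* For each $i\in\mathcal N$ let $\mathcal X_i\subset\mathbb R^{m_i}$ be a closed and compact convex set and let $r_i$ be its indicator function ($0$ on $\mathcal X_i$, $+\infty$ elsewhere). Assume the following for every $i\in\mathcal N$. (1) For every fixed $x_{-i}\in\prod_{j\ne i}\mathcal X_j$ the map $x_i\mapsto f_i(x_i,h_i(x_i)+\sigma(x_{-i}))$ is convex on $\mathcal X_i$; and $f_i$ is continuously differentiable in $(x_i,\sigma)$ on an open set containing $\mathcal X_i\times\mathbb R^m$. (2) $\phi$ is Lipschitz continuous and monotone on $\mathcal X=\prod_{i=1}^N\mathcal X_i$. (3) $h_i$ is $L_{hi}$-Lipschitz on $\mathcal X_i$; and for every $c_z>0$ there is a constant $L_{fi}$ (possibly depending on $c_z$) such that $\|F_i(x_i,z_1)-F_i(x_i,z_2)\|\le L_{fi}\|z_1-z_2\|$ for all $x_i\in\mathcal X_i$ and all $z_1,z_2\in\mathbb R^m$ with $\|z_1\|,\|z_2\|\le c_z$. (4) $\psi_i(\cdot,\cdot;\xi_i)$ is differentiable on $\mathcal C_i\times\mathbb R^m$ for every fixed $\xi_i\in\mathbb R^{d_i}$, where $\mathcal C_i$ is an open set containing $\mathcal X_i$; and for all $x_i\in\mathcal X_i$, $z_i\in\mathbb R^m$, $\mathbb E[q_i(x_i,z_i;\xi_i)\mid x_i]=F_i(x_i,z_i)$ and $\mathbb E[\|q_i(x_i,z_i;\xi_i)-F_i(x_i,z_i)\|^2\mid x_i]\le\upsilon_i^2$ for some $\upsilon_i>0$. (5) $W_k$ is doubly stochastic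 for all $k\ge0$; there is $\varsigma\in(0,1)$ with $\omega_{ij,k}\ge\varsigma$ for all $k\ge 0$, $i\in\mathcal N$, $j\in\mathcal N_{i,k}$; and there is a positive integer $P$ such that the graph $(\mathcal N,\bigcup_{l=1}^P\mathcal E_{k+l})$ is strongly connected for every $k\ge0$. Let $\beta=\big(1-\frac{\varsigma}{4N^2}\big)^{1/P}\in(0,1)$. For each $i$ set $\alpha_{i,k}=(k+\lambda_i)^{-a}$ and $\eta_{i,k}=(k+\delta_i)^{-b}$ for some $\lambda_i>0$, $\delta_i>0$, with $a\in(1/2,1)$, $a>b>0$ and $a+b<1$. Let $\hat x_K$ be the averaged sequence of the algorithm described in the context. Then there exist positive constants $C_{g1}$ and $C_{g2}$ such that $$\mathbb E[G(\hat x_K)]\le C_{g1}NK^{-b}+C_{g2}N^5\beta^{-1}(1-\beta)^{-2}K^{a-1},\qquad\forall K\ge1.$$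
   Context: Game. There are $N$ players, $\mathcal N=\{1,\dots,N\}$; player $i$ controls $x_i\in\mathbb R^{m_i}$, $m=\sum_i m_i$, $x=(x_1,\dots,x_N)$, $x_{-i}=(x_j)_{j\ne i}$. The functions $h_j:\mathbb R^{m_j}\to\mathbb R^m$ are continuously differentiable, $\sigma(x)=\sum_{j=1}^N h_j(x_j)$ and $\sigma(x_{-i})=\sum_{j\ne i}h_j(x_j)$. Given $x_{-i}$, player $i$ minimizes $f_i(x_i,h_i(x_i)+\sigma(x_{-i}))+r_i(x_i)$ over $x_i$, where $f_i(x_i,s)=\mathbb E[\psi_i(x_i,s;\xi_i)]$, $\xi_i$ is an $\mathbb R^{d_i}$-valued random variable and $\psi_i:\mathbb R^{m_i}\times\mathbb R^m\times\mathbb R^{d_i}\to\mathbb R$. Maps. $F_i(x_i,z_i)=\big(\nabla_{x_i}f_i(x_i,\sigma)+\nabla h_i(x_i)\nabla_\sigma f_i(x_i,\sigma)\big)\big|_{\sigma=z_i}$ ($\nabla h_i$ is the transposed Jacobian), $\phi_i(x)=F_i(x_i,\sigma(x))$, $\phi=(\phi_1,\dots,\phi_N)$, and $q_i(x_i,z_i;\xi_i)=\big(\nabla_{x_i}\psi_i(x_i,\sigma;\xi_i)+\nabla h_i(x_i)\nabla_\sigma\psi_i(x_i,\sigma;\xi_i)\big)\big|_{\sigma=z_i}$. "Monotone on $\mathcal X$" means $(\phi(x)-\phi(x'))^T(x-x')\ge0$ for all $x,x'\in\mathcal X$. $\|\cdot\|$ is the Euclidean norm. Gap function: $G(x)=\sup_{y\in\mathcal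 X}(x-y)^T\phi(y)$ for $x\in\mathcal X$. Network. At time $k$, players communicate over a digraph $\mathcal G_k=(\mathcal N,\mathcal E_k)$, $(j,i)\in\mathcal E_k$ meaning $i$ receives information from $j$; $\mathcal N_{i,k}=\{j:(j,i)\in\mathcal E_k\}$, and $i\in\mathcal N_{i,k}$. $W_k=[\omega_{ij,k}]$ is the nonnegative matrix with $\omega_{ij,k}>0$ iff $(j,i)\in\mathcal E_k$, and $\omega_{ij,k}=0$ otherwise. Algorithm. Start with $x_{i,0}\in\mathcal X_i$, $v_{i,0}=h_i(x_{i,0})$. For $k=0,1,2,\dots$ and each $i$: $\hat v_{i,k}=\sum_{j\in\mathcal N_{i,k}}\omega_{ij,k}v_{j,k}$; $x_{i,k+1}=\Pi_{\mathcal X_i}\big(x_{i,k}-\alpha_{i,k}(q_i(x_{i,k},N\hat v_{i,k};\xi_{i,k})+\eta_{i,k}x_{i,k})\big)$ with $\Pi_{\mathcal X_i}$ the Euclidean projection; $v_{i,k+1}=\hat v_{i,k}+h_i(x_{i,k+1})-h_i(x_{i,k})$. Here $\xi_{i,k}$ is a fresh realization of $\xi_i$ at time $k$; with $\zeta_{i,k}=q_i(x_{i,k},N\hat v_{i,k};\xi_{i,k})-F_i(x_{i,k},N\hat v_{i,k})$ and $\mathcal F_k$ the $\sigma$-algebra generated by $x_0$ and $\zeta_{i,l}$, $i\in\mathcal N$, $0\le l\le k-1$, the sampling is such that $\mathbb E[\zeta_{i,k}\mid\mathcal F_k]=0$ and $\mathbb E[\|\zeta_{i,k}\|^2\mid\mathcal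 F_k]\le\upsilon_i^2$ a.s. Averaged sequence: $x_k=(x_{1,k},\dots,x_{N,k})$, $\alpha_{\max,k}=\max_i\alpha_{i,k}$, $\hat x_K=\frac{\sum_{p=0}^{K-1}\alpha_{\max,p}x_p}{\sum_{p=0}^{K-1}\alpha_{\max,p}}$. *)

theory Defs
  imports "HOL-Probability.Probability" "Graph_Theory.Graph_Theory"
begin

text \<open>
  The strategy spaces have player-dependent dimensions.  The coordinates of the stacked vector of
  all strategies are indexed by a finite type \<open>'m\<close>, and \<open>own c\<close> is the player who controls
  coordinate \<open>c\<close>.  Player \<open>i\<close>'s space of dimension \<open>card {c. own c = i}\<close> is the coordinate
  subspace \<open>block own i\<close> of \<^typ>\<open>real^'m\<close>, and these dimensions sum to \<open>CARD('m)\<close>.  A function on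
  player \<open>i\<close>'s space is a function on \<^typ>\<open>real^'m\<close> of which only the values on \<open>block own i\<close>
  matter, and all of its calculus is done within that subspace.
\<close>

definition block :: "('m::finite \<Rightarrow> 'n) \<Rightarrow> 'n \<Rightarrow> (real^'m) set" where
  "block own i = {x. \<forall>c. own c \<noteq> i \<longrightarrow> x $ c = 0}"

definition player_part :: "('m::finite \<Rightarrow> 'n) \<Rightarrow> 'n \<Rightarrow> real^'m \<Rightarrow> real^'m" where
  "player_part own i x = (\<chi> c. if own c = i then x $ c else 0)"

text \<open>
  Gradient of a function on the subspace \<open>E\<close>.  Membership in \<open>E\<close> makes the gradient unique, since
  the derivative within \<open>E\<close> is only determined on \<open>E\<close>.
\<close>

definition grad_on :: "'a::real_inner set \<Rightarrow> ('a \<Rightarrow> real) \<Rightarrow> 'a \<Rightarrow> 'a" where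
  "grad_on E g x = (THE v. v \<in> E \<and> (g has_derivative (\<lambda>u. v \<bullet> u)) (at x within E))"

lemma grad_on_unique:
  assumes E: "subspace E" and x: "x \<in> E" and v: "v \<in> E"
    and D: "(g has_derivative (\<lambda>u. v \<bullet> u)) (at x within E)"
  shows "grad_on E g x = v"
  unfolding grad_on_def
proof (rule the_equality)
  fix w assume w: "w \<in> E \<and> (g has_derivative (\<lambda>u. w \<bullet> u)) (at x within E)"
  define d where "d = w - v"
  have dE: "d \<in> E"
    using E w v by (simp add: d_def subspace_diff)
  have 0: "((\<lambda>y. 0) has_derivative (\<lambda>u. d \<bullet> u)) (at x within E)"
    using has_derivative_diff[OF conjunct2[OF w] D] by (simp add: d_def inner_diff_left)
  have line: "((\<lambda>t::real. x + t *\<^sub>R d) has_derivative (\<lambda>t. t *\<^sub>R d)) (at 0)"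
    by (auto intro!: derivative_eq_intros)
  have "((\<lambda>y. 0) has_derivative (\<lambda>u. d \<bullet> u))
      (at (x + 0 *\<^sub>R d) within ((\<lambda>t::real. x + t *\<^sub>R d) ` UNIV))"
    by (rule has_derivative_subset[of _ _ _ E])
      (use 0 E x dE in \<open>auto intro: subspace_add subspace_scale\<close>)
  from has_derivative_in_compose[OF line this]
  have "((\<lambda>t::real. 0::real) has_derivative (\<lambda>t. d \<bullet> (t *\<^sub>R d))) (at 0)"
    by simp
  then have "(\<lambda>t. d \<bullet> (t *\<^sub>R d)) = (\<lambda>t. 0)"
    using has_derivative_unique has_derivative_const by metis
  then have "d \<bullet> (1 *\<^sub>R d) = 0"
    by metis
  then show "w = v"
    by (simp add: d_def)
qed (use v D in simp)

text \<open>
  Transposed Jacobian: column \<open>l\<close> is the gradient of the \<open>l\<close>-th component.  With \<open>E = block own i\<close>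
  the rows of coordinates not owned by \<open>i\<close> vanish.
\<close>

definition transp_jacobian_on ::
  "(real^'m::finite) set \<Rightarrow> (real^'m \<Rightarrow> real^'l::finite) \<Rightarrow> real^'m \<Rightarrow> real^'l^'m" where
  "transp_jacobian_on E h x = (\<chi> c l. grad_on E (\<lambda>y. h y $ l) x $ c)"

text \<open>Both \<open>F\<^sub>i\<close> (from \<open>f\<^sub>i\<close>) and \<open>q\<^sub>i\<close> (from \<open>\<psi>\<^sub>i\<close> at a fixed sample) are instances of this map.\<close>

definition aggr_grad ::
  "(real^'m::finite) set \<Rightarrow> (real^'m \<Rightarrow> real^'l::finite) \<Rightarrow> (real^'m \<Rightarrow> real^'l \<Rightarrow> real)
    \<Rightarrow> real^'m \<Rightarrow> real^'l \<Rightarrow> real^'m" where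
  "aggr_grad E h g x z =
     grad_on E (\<lambda>u. g u z) x + transp_jacobian_on E h x *v grad_on UNIV (\<lambda>s. g x s) z"

definition cont_diff_on ::
  "'a::real_normed_vector set \<Rightarrow> 'a set \<Rightarrow> ('a \<Rightarrow> 'b::real_normed_vector) \<Rightarrow> bool" where
  "cont_diff_on E U g \<longleftrightarrow>
     (\<exists>D. continuous_on U D \<and> (\<forall>x\<in>U. (g has_derivative blinfun_apply (D x)) (at x within E)))"

definition doubly_stochastic :: "real^'n^'n::finite \<Rightarrow> bool" where
  "doubly_stochastic W \<longleftrightarrow>
     (\<forall>i j. 0 \<le> W $ i $ j) \<and> (\<forall>i. (\<Sum>j\<in>UNIV. W $ i $ j) = 1) \<and> (\<forall>j. (\<Sum>i\<in>UNIV. W $ i $ j) = 1)"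

text \<open>
  \<open>d\<close>-dimensional Euclidean space as a measurable space, for sample vectors with player-dependent
  \<open>d\<close>; its points are the extensional functions on \<open>{..<d}\<close>.
\<close>

definition borel_vec :: "nat \<Rightarrow> (nat \<Rightarrow> real) measure" where
  "borel_vec d = (\<Pi>\<^sub>M l\<in>{..<d}. borel)"

text \<open>The \<open>\<sigma>\<close>-algebra generated by \<open>x0\<close> and by \<open>\<zeta> i l\<close> for all \<open>i\<close> and \<open>l < k\<close>.\<close>

definition history ::
  "'w measure \<Rightarrow> ('w \<Rightarrow> 'a::topological_space) \<Rightarrow> ('n \<Rightarrow> nat \<Rightarrow> 'w \<Rightarrow> 'b::topological_space)
    \<Rightarrow> nat \<Rightarrow> 'w measure" where
  "history M x0 \<zeta> k = sigma (space M)
     ({x0 -` B \<inter> space M |B. B \<in> sets borel} \<union>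
      {\<zeta> i l -` B \<inter> space M |i l B. l < k \<and> B \<in> sets borel})"

definition gap :: "'a::real_inner set \<Rightarrow> ('a \<Rightarrow> 'a) \<Rightarrow> 'a \<Rightarrow> real" where
  "gap X \<phi> x = (SUP y\<in>X. (x - y) \<bullet> \<phi> y)"

end

theory Submission
  imports Defs
begin

text \<open>
  Since the constants may depend on the data, only the order \<open>K\<^sup>-\<^sup>b + K\<^sup>a\<^sup>-\<^sup>1\<close> matters.
  Expanding the squared distance of the projected step to a point \<open>y\<close> and summing over \<open>k\<close>
  bounds \<open>\<Sum>\<^sub>k \<alpha>\<^sub>m\<^sub>a\<^sub>x\<^sub>,\<^sub>k (x\<^sub>k - y) \<bullet> \<phi> x\<^sub>k\<close>, hence by monotonicity the gap of the average times
  \<open>\<Sum>\<^sub>k \<alpha>\<^sub>m\<^sub>a\<^sub>x\<^sub>,\<^sub>k \<ge> c K\<^sup>1\<^sup>-\<^sup>a\<close>.  The regularisation contributes \<open>\<Sum>\<^sub>k \<alpha>\<^sub>k \<eta>\<^sub>k = O(K\<^sup>1\<^sup>-\<^sup>a\<^sup>-\<^sup>b)\<close>;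
  every other term is bounded in expectation:
  the mismatch of the step sizes telescopes; the noise is a martingale difference sequence with
  \<open>\<Sum>\<^sub>k \<alpha>\<^sub>k\<^sup>2 < \<infinity>\<close>; and the tracking error is driven by increments of size \<open>O(\<alpha>\<^sub>k)\<close> and contracted by a
  factor \<open>\<rho> < 1\<close> over a fixed number of rounds, because the products of sufficiently many mixing
  matrices have uniformly positive entries, so that \<open>\<Sum>\<^sub>k \<alpha>\<^sub>k E[error\<^sub>k] \<le> C \<Sum>\<^sub>k \<alpha>\<^sub>k\<^sup>2\<close>.
\<close>

section \<open>Mixing by doubly stochastic matrices\<close>

text \<open>The supremum in the gap stands inside the expectation, so the comparison point y may
  depend on the noise and \<zeta> \<bullet> (x - y) cannot simply be averaged away. It is split:
  \<zeta> \<bullet> x has mean zero because x is determined by earlier noise, while \<zeta>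
  \<bullet> y is first summed over time, which leaves the norm of one martingale times the radius of
  the strategy sets. A second obstacle is that \<open>F\<close> is Lipschitz in the aggregate only
  on bounded sets while the noise is unbounded. Mixing is perturbed only by increments of
  \<open>h\<close> on compact sets, so the tracking variables stay in a fixed ball on every path;
  this fixes the Lipschitz constant before any expectation is taken. The finer O(\<alpha>) size of
  the increments is obtained in expectation. The weights of the average are the largest step sizes,
  whereas each player descends with an individual one. The differences can be summed because the
  player with the smallest shift attains the maximum at every time. Dividing by K^(1-a) turns the
  regularisation term into K^(-b) and all bounded terms into K^(a-1).\<close>

lemma strongly_connected_exits:
  fixes A :: "('n \<times> 'n) set"
  assumes sc: "strongly_connected (with_proj \<lparr>pverts = UNIV, parcs = A\<rparr>)"
    and S: "S \<noteq> {}" "S \<noteq> UNIV"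
  shows "\<exists>u w. (u, w) \<in> A \<and> u \<in> S \<and> w \<notin> S"
proof (rule ccontr)
  assume no: "\<not> ?thesis"
  obtain u w where uw: "u \<in> S" "w \<notin> S" using S by blast
  have "u \<rightarrow>\<^sup>*\<^bsub>with_proj \<lparr>pverts = UNIV, parcs = A\<rparr>\<^esub> w"
    using sc by (simp add: strongly_connected_def)
  then have "(u, w) \<in> (arcs_ends (with_proj \<lparr>pverts = UNIV, parcs = A\<rparr>))\<^sup>*"
    by (rule reachable_rtranclI)
  moreover have "arcs_ends (with_proj \<lparr>pverts = UNIV, parcs = A\<rparr>) = A"
    by (auto simp: arcs_ends_conv)
  ultimately have "(u, w) \<in> A\<^sup>*" by simp
  then have "w \<in> S" using uw(1) no by (induction rule: rtrancl_induct) auto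
  with uw show False by simp
qed

lemma doubly_stochastic_mat_1: "doubly_stochastic (mat 1)"
  by (auto simp: doubly_stochastic_def mat_def)

lemma doubly_stochastic_mult:
  assumes "doubly_stochastic A" "doubly_stochastic B"
  shows "doubly_stochastic (A ** B)"
proof -
  have r: "(\<Sum>j\<in>UNIV. \<Sum>k\<in>UNIV. A $ i $ k * B $ k $ j) = 1" for i
    by (subst sum.swap) (use assms in \<open>simp add: doubly_stochastic_def flip: sum_distrib_left\<close>)
  have c: "(\<Sum>i\<in>UNIV. \<Sum>k\<in>UNIV. A $ i $ k * B $ k $ j) = 1" for j
    by (subst sum.swap) (use assms in \<open>simp add: doubly_stochastic_def flip: sum_distrib_right\<close>)
  show ?thesis
    using assms r c
    by (auto simp: doubly_stochastic_def matrix_matrix_mult_def intro!: sum_nonneg)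
qed

lemma doubly_stochastic_le_1:
  assumes "doubly_stochastic A" shows "A $ i $ j \<le> 1"
  using assms member_le_sum[of j UNIV "\<lambda>j. A $ i $ j"] by (auto simp: doubly_stochastic_def)

text \<open>Newest factor on the left: the matrix carries values at time \<open>s\<close> to values
  at time \<open>s + n\<close>.\<close>

fun transition :: "(nat \<Rightarrow> real^'n^'n::finite) \<Rightarrow> nat \<Rightarrow> nat \<Rightarrow> real^'n^'n" where
  "transition W s 0 = mat 1"
| "transition W s (Suc n) = W (s + n) ** transition W s n"

lemma doubly_stochastic_transition:
  assumes "\<And>k. doubly_stochastic (W k)"
  shows "doubly_stochastic (transition W s n)"
  by (induction n) (use assms in \<open>auto intro: doubly_stochastic_mult doubly_stochastic_mat_1\<close>)

text \<open>In a fixed column, the set of rows whose entry has reached the threshold never shrinks,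
  by the self-loops, and gains a row in each window of \<open>Suc P\<close> rounds, by connectivity.
  After \<open>CARD('n)\<close> windows it contains every row.\<close>

lemma transition_ge:
  fixes W :: "nat \<Rightarrow> real^'n^'n::finite"
  assumes self: "\<And>k i. (i, i) \<in> E k"
    and ds: "\<And>k. doubly_stochastic (W k)"
    and w: "0 < w" "\<And>k i j. (j, i) \<in> E k \<Longrightarrow> w \<le> W k $ i $ j"
    and sc: "\<And>k. strongly_connected
           (with_proj \<lparr>pverts = UNIV, parcs = (\<Union>l\<in>{1..P}. E (k + l))\<rparr>)"
  shows "w ^ (CARD('n) * Suc P) \<le> transition W s (CARD('n) * Suc P) $ i $ j"
proof -
  \<comment> \<open>The threshold drops by a factor \<open>w\<close> per round, exactly what passing
    along one edge of weight at least \<open>w\<close> costs.\<close>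
  define R where "R n = {i. w ^ n \<le> transition W s n $ i $ j}" for n
  have step: "i \<in> R (Suc n)" if "u \<in> R n" "(u, i) \<in> E (s + n)" for u i n
  proof -
    have "w * w ^ n \<le> W (s + n) $ i $ u * transition W s n $ u $ j"
      using that w by (intro mult_mono) (auto simp: R_def intro: order_trans[of 0 w])
    also have "\<dots> \<le> (\<Sum>l\<in>UNIV. W (s + n) $ i $ l * transition W s n $ l $ j)"
      using ds[of "s + n"] doubly_stochastic_transition[of W s n, OF ds]
      by (intro member_le_sum[of u UNIV "\<lambda>l. W (s + n) $ i $ l * transition W s n $ l $ j"])
         (auto simp: doubly_stochastic_def)
    finally show ?thesis by (simp add: R_def matrix_matrix_mult_def)
  qed
  have mono: "R n \<subseteq> R (n + l)" for n l
    by (induction l) (use step self in fastforce)+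
  \<comment> \<open>The union of edge sets runs over offsets 1 to P, and the edge at offset
    \<open>l\<close> acts between rounds \<open>n + l\<close> and \<open>n + l + 1\<close>; hence
    the window length \<open>Suc P\<close>.\<close>
  have grow: "card (R n) < card (R (n + Suc P))" if R: "R n \<noteq> UNIV" "R n \<noteq> {}" for n
  proof -
    obtain u i where ui: "(u, i) \<in> (\<Union>l\<in>{1..P}. E (s + n + l))" "u \<in> R n" "i \<notin> R n"
      using strongly_connected_exits[OF sc R(2,1)] by blast
    then obtain l where l: "l \<le> P" "(u, i) \<in> E (s + n + l)" by auto
    have "i \<in> R (Suc (n + l))"
      using step[of u "n + l" i] l ui(2) mono[of n l] by (auto simp: add.assoc)
    then have "i \<in> R (n + Suc P)"
      using mono[of "Suc (n + l)" "P - l"] l(1) by auto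
    then have "R n \<subset> R (n + Suc P)" using ui(3) mono[of n "Suc P"] by blast
    then show ?thesis by (intro psubset_card_mono) auto
  qed
  \<comment> \<open>\<open>R 0\<close> contains the column index itself, since the empty product is
    the identity.\<close>
  have ne: "R n \<noteq> {}" for n
    using mono[of 0 n] by (auto simp: R_def mat_def)
  have "R (m * Suc P) = UNIV \<or> m \<le> card (R (m * Suc P))" for m
  proof (induction m)
    case (Suc m)
    show ?case
    proof (cases "R (m * Suc P) = UNIV")
      case True
      then have "R (m * Suc P + Suc P) = UNIV" using mono[of "m * Suc P" "Suc P"] by blast
      then show ?thesis by (simp add: ac_simps)
    next
      case False
      then have "Suc m \<le> card (R (m * Suc P + Suc P))" using Suc grow[OF False ne] by linarith
      then show ?thesis by (metis mult_Suc add.commute)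
    qed
  qed simp
  then have "R (CARD('n) * Suc P) = UNIV"
    using card_subset_eq[of UNIV "R (CARD('n) * Suc P)"] card_mono[of UNIV "R (CARD('n) * Suc P)"]
    by (metis finite le_antisym subset_UNIV)
  then show ?thesis by (auto simp: R_def)
qed

section \<open>Disagreement and its contraction\<close>

definition mean :: "('n::finite \<Rightarrow> 'b::real_vector) \<Rightarrow> 'b" where
  "mean v = (\<Sum>i\<in>UNIV. v i) /\<^sub>R real CARD('n)"

text \<open>The sum of norms, rather than a Euclidean norm, fits the column sums: mixing does not
  increase it, and a lower bound on the matrix entries yields a contraction factor directly.\<close>

definition disagreement :: "('n::finite \<Rightarrow> 'b::real_normed_vector) \<Rightarrow> real" where
  "disagreement v = (\<Sum>i\<in>UNIV. norm (v i - mean v))"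

lemma sum_eq_mean: "(\<Sum>i\<in>UNIV. v i) = real CARD('n) *\<^sub>R mean (v :: 'n::finite \<Rightarrow> 'b::real_vector)"
  by (simp add: mean_def)

lemma disagreement_nonneg: "0 \<le> disagreement v"
  by (simp add: disagreement_def sum_nonneg)

lemma sum_doubly_stochastic:
  fixes v :: "'n::finite \<Rightarrow> 'b::real_vector"
  assumes "doubly_stochastic A"
  shows "(\<Sum>i\<in>UNIV. \<Sum>j\<in>UNIV. A $ i $ j *\<^sub>R v j) = (\<Sum>j\<in>UNIV. v j)"
  by (subst sum.swap) (use assms in \<open>simp add: doubly_stochastic_def flip: scaleR_left.sum\<close>)

lemma mean_doubly_stochastic:
  assumes "doubly_stochastic A"
  shows "mean (\<lambda>i. \<Sum>j\<in>UNIV. A $ i $ j *\<^sub>R v j) = mean v"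
  by (simp add: mean_def sum_doubly_stochastic[OF assms])

lemma mean_add: "mean (\<lambda>i. u i + v i) = mean u + mean v"
  by (simp add: mean_def sum.distrib scaleR_add_right)

lemma sum_norm_doubly_stochastic_le:
  fixes v :: "'n::finite \<Rightarrow> 'b::real_normed_vector"
  assumes "doubly_stochastic A"
  shows "(\<Sum>i\<in>UNIV. norm (\<Sum>j\<in>UNIV. A $ i $ j *\<^sub>R v j)) \<le> (\<Sum>j\<in>UNIV. norm (v j))"
proof -
  have "(\<Sum>i\<in>UNIV. norm (\<Sum>j\<in>UNIV. A $ i $ j *\<^sub>R v j))
      \<le> (\<Sum>i\<in>UNIV. \<Sum>j\<in>UNIV. A $ i $ j *\<^sub>R norm (v j))"
    by (intro sum_mono norm_sum[THEN order_trans])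
       (use assms in \<open>simp add: doubly_stochastic_def\<close>)
  then show ?thesis by (simp only: sum_doubly_stochastic[OF assms])
qed

text \<open>Rows sum to one, so the mean can be moved inside; entries at most one then bound one
  agent's error by the total disagreement. This is how the tracking error of a single player is
  controlled.\<close>

lemma norm_mixed_minus_mean_le:
  fixes v :: "'n::finite \<Rightarrow> 'b::real_normed_vector"
  assumes "doubly_stochastic A"
  shows "norm ((\<Sum>j\<in>UNIV. A $ i $ j *\<^sub>R v j) - mean v) \<le> disagreement v"
proof -
  have "(\<Sum>j\<in>UNIV. A $ i $ j *\<^sub>R v j) - mean v = (\<Sum>j\<in>UNIV. A $ i $ j *\<^sub>R (v j - mean v))"
    using assms
    by (simp add: doubly_stochastic_def scaleR_diff_right sum_subtractf flip: scaleR_left.sum)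
  also have "norm \<dots> \<le> (\<Sum>j\<in>UNIV. norm (v j - mean v))"
    using assms doubly_stochastic_le_1[OF assms]
    by (intro norm_sum[THEN order_trans] sum_mono)
       (auto simp: doubly_stochastic_def intro!: mult_left_le_one_le)
  finally show ?thesis by (simp add: disagreement_def)
qed

text \<open>The deviations from the mean sum to zero, so \<open>c\<close> may be subtracted from every entry.\<close>

lemma disagreement_contraction:
  fixes v :: "'n::finite \<Rightarrow> 'b::real_normed_vector"
  assumes ds: "doubly_stochastic A" and c: "\<And>i j. c \<le> A $ i $ j"
  shows "(\<Sum>i\<in>UNIV. norm ((\<Sum>j\<in>UNIV. A $ i $ j *\<^sub>R v j) - mean v))
           \<le> (1 - real CARD('n) * c) * disagreement v"
proof -
  have 0: "(\<Sum>j\<in>UNIV. v j - mean v) = 0"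
    by (simp add: sum_subtractf sum_eq_mean sum_constant_scaleR)
  have eq: "(\<Sum>j\<in>UNIV. A $ i $ j *\<^sub>R v j) - mean v
      = (\<Sum>j\<in>UNIV. (A $ i $ j - c) *\<^sub>R (v j - mean v))" for i
  proof -
    have "(\<Sum>j\<in>UNIV. (A $ i $ j - c) *\<^sub>R (v j - mean v))
        = (\<Sum>j\<in>UNIV. A $ i $ j *\<^sub>R (v j - mean v)) - c *\<^sub>R (\<Sum>j\<in>UNIV. v j - mean v)"
      unfolding scaleR_sum_right by (simp add: scaleR_left_diff_distrib sum_subtractf)
    also have "\<dots> = (\<Sum>j\<in>UNIV. A $ i $ j *\<^sub>R v j) - (\<Sum>j\<in>UNIV. A $ i $ j) *\<^sub>R mean v"
      unfolding 0 by (simp add: scaleR_diff_right sum_subtractf scaleR_left.sum)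
    finally show ?thesis using ds by (simp add: doubly_stochastic_def)
  qed
  have "(\<Sum>i\<in>UNIV. norm ((\<Sum>j\<in>UNIV. A $ i $ j *\<^sub>R v j) - mean v))
      \<le> (\<Sum>i\<in>UNIV. \<Sum>j\<in>UNIV. (A $ i $ j - c) * norm (v j - mean v))"
    unfolding eq by (intro sum_mono norm_sum[THEN order_trans]) (use c in simp)
  also have "\<dots> = (\<Sum>j\<in>UNIV. (\<Sum>i\<in>UNIV. A $ i $ j - c) * norm (v j - mean v))"
    by (subst sum.swap) (simp add: sum_distrib_right)
  also have "\<dots> = (1 - real CARD('n) * c) * disagreement v"
    using ds by (simp add: doubly_stochastic_def sum_subtractf disagreement_def sum_distrib_left)
  finally show ?thesis .
qed

text \<open>Unrolls the recursion. \<open>w\<close> collects all perturbations so far; since mixing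
  does not increase the sum of norms, older perturbations are never amplified.\<close>

lemma perturbed_transition:
  fixes v e :: "nat \<Rightarrow> 'n::finite \<Rightarrow> 'b::real_normed_vector"
  assumes ds: "\<And>k. doubly_stochastic (W k)"
    and step: "\<And>k i. v (Suc k) i = (\<Sum>j\<in>UNIV. W k $ i $ j *\<^sub>R v k j) + e k i"
  shows "\<exists>w. (\<forall>i. v (s + n) i = (\<Sum>j\<in>UNIV. transition W s n $ i $ j *\<^sub>R v s j) + w i)
           \<and> (\<Sum>i\<in>UNIV. norm (w i)) \<le> (\<Sum>l<n. \<Sum>i\<in>UNIV. norm (e (s + l) i))"
proof (induction n)
  case 0
  have "(\<Sum>j\<in>UNIV. mat 1 $ i $ j *\<^sub>R v s j) = v s i" for i
  proof -
    have "(\<Sum>j\<in>UNIV. mat 1 $ i $ j *\<^sub>R v s j) = (\<Sum>j\<in>UNIV. if j = i then v s j else 0)"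
      by (intro sum.cong) (auto simp: mat_def)
    then show ?thesis by simp
  qed
  then show ?case by (intro exI[of _ "\<lambda>_. 0"]) simp
next
  case (Suc n)
  then obtain w where w: "\<And>i. v (s + n) i = (\<Sum>j\<in>UNIV. transition W s n $ i $ j *\<^sub>R v s j) + w i"
    and wn: "(\<Sum>i\<in>UNIV. norm (w i)) \<le> (\<Sum>l<n. \<Sum>i\<in>UNIV. norm (e (s + l) i))"
    by blast
  define w' where "w' i = (\<Sum>j\<in>UNIV. W (s + n) $ i $ j *\<^sub>R w j) + e (s + n) i" for i
  have "v (s + Suc n) i = (\<Sum>j\<in>UNIV. transition W s (Suc n) $ i $ j *\<^sub>R v s j) + w' i" for i
  proof -
    have "(\<Sum>j\<in>UNIV. W (s + n) $ i $ j *\<^sub>R (\<Sum>l\<in>UNIV. transition W s n $ j $ l *\<^sub>R v s l))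
        = (\<Sum>l\<in>UNIV. transition W s (Suc n) $ i $ l *\<^sub>R v s l)"
      unfolding scaleR_sum_right
      by (subst sum.swap) (simp add: matrix_matrix_mult_def scaleR_left.sum)
    then show ?thesis
      by (simp add: step w w'_def scaleR_add_right sum.distrib)
  qed
  moreover have "(\<Sum>i\<in>UNIV. norm (w' i)) \<le> (\<Sum>l<Suc n. \<Sum>i\<in>UNIV. norm (e (s + l) i))"
  proof -
    have "(\<Sum>i\<in>UNIV. norm (w' i)) \<le> (\<Sum>i\<in>UNIV. norm (\<Sum>j\<in>UNIV. W (s + n) $ i $ j *\<^sub>R w j))
        + (\<Sum>i\<in>UNIV. norm (e (s + n) i))"
      unfolding w'_def sum.distrib[symmetric] by (intro sum_mono norm_triangle_ineq)
    then show ?thesis using sum_norm_doubly_stochastic_le[OF ds[of "s + n"], of w] wn by simp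
  qed
  ultimately show ?case by blast
qed

text \<open>The accumulated perturbation enters twice, once directly and once by shifting the mean;
  hence the factor 2.\<close>

lemma perturbed_disagreement_le:
  fixes v e :: "nat \<Rightarrow> 'n::finite \<Rightarrow> 'b::real_normed_vector"
  assumes ds: "\<And>k. doubly_stochastic (W k)"
    and step: "\<And>k i. v (Suc k) i = (\<Sum>j\<in>UNIV. W k $ i $ j *\<^sub>R v k j) + e k i"
    and c: "\<And>i j. c \<le> transition W s n $ i $ j"
  shows "disagreement (v (s + n)) \<le> (1 - real CARD('n) * c) * disagreement (v s)
           + 2 * (\<Sum>l<n. \<Sum>i\<in>UNIV. norm (e (s + l) i))"
proof -
  let ?T = "transition W s n"
  obtain w where w: "\<And>i. v (s + n) i = (\<Sum>j\<in>UNIV. ?T $ i $ j *\<^sub>R v s j) + w i"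
    and wn: "(\<Sum>i\<in>UNIV. norm (w i)) \<le> (\<Sum>l<n. \<Sum>i\<in>UNIV. norm (e (s + l) i))"
    using perturbed_transition[of W v e s n, OF ds step] by blast
  have T: "doubly_stochastic ?T" by (rule doubly_stochastic_transition[OF ds])
  have "v (s + n) = (\<lambda>i. (\<Sum>j\<in>UNIV. ?T $ i $ j *\<^sub>R v s j) + w i)" using w by blast
  then have m: "mean (v (s + n)) = mean (v s) + mean w"
    by (simp add: mean_add mean_doubly_stochastic[OF T])
  have "disagreement (v (s + n))
      \<le> (\<Sum>i\<in>UNIV. norm ((\<Sum>j\<in>UNIV. ?T $ i $ j *\<^sub>R v s j) - mean (v s)) + (norm (w i) + norm (mean w)))"
    unfolding disagreement_def m unfolding w by (intro sum_mono) norm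
  also have "\<dots> = (\<Sum>i\<in>UNIV. norm ((\<Sum>j\<in>UNIV. ?T $ i $ j *\<^sub>R v s j) - mean (v s)))
      + ((\<Sum>i\<in>UNIV. norm (w i)) + real CARD('n) * norm (mean w))"
    by (simp add: sum.distrib)
  also have "real CARD('n) * norm (mean w) \<le> (\<Sum>i\<in>UNIV. norm (w i))"
    using norm_sum[of w UNIV] by (simp add: mean_def field_simps)
  finally show ?thesis
    using disagreement_contraction[OF T c, of "v s"] wn by linarith
qed

text \<open>Packs two cases into one inequality: contraction over exactly \<open>B\<close> rounds
  and non-expansion over any other number. \<open>B\<close> and \<rho> are fixed before the sequence
  is, because the bound is applied to each sample path separately.\<close>

lemma consensus:
  fixes W :: "nat \<Rightarrow> real^'n^'n::finite"
  assumes self: "\<And>k i. (i, i) \<in> E k"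
    and ds: "\<And>k. doubly_stochastic (W k)"
    and w: "0 < w" "\<And>k i j. (j, i) \<in> E k \<Longrightarrow> w \<le> W k $ i $ j"
    and sc: "\<And>k. strongly_connected
           (with_proj \<lparr>pverts = UNIV, parcs = (\<Union>l\<in>{1..P}. E (k + l))\<rparr>)"
  obtains B :: nat and \<rho> :: real where "0 < B" "0 \<le> \<rho>" "\<rho> < 1"
    "\<And>(v :: nat \<Rightarrow> 'n \<Rightarrow> 'b::real_normed_vector) e s n.
      (\<And>k i. v (Suc k) i = (\<Sum>j\<in>UNIV. W k $ i $ j *\<^sub>R v k j) + e k i) \<Longrightarrow>
      disagreement (v (s + n)) \<le> (if n = B then \<rho> else 1) * disagreement (v s)
           + 2 * (\<Sum>l<n. \<Sum>i\<in>UNIV. norm (e (s + l) i))"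
proof -
  define B where "B = CARD('n) * Suc P"
  define c where "c = w ^ B"
  have "c \<le> transition W 0 B $ i $ j" for i j
    unfolding c_def B_def by (rule transition_ge[of E W w P, OF self ds w sc])
  \<comment> \<open>Summing the entry bound along one row, which adds up to one, gives N c \<le> 1
    and so \<rho> = 1 - N c \<ge> 0.\<close>
  then have "(\<Sum>j\<in>(UNIV::'n set). c) \<le> (\<Sum>j\<in>UNIV. transition W 0 B $ undefined $ j)"
    by (intro sum_mono)
  then have "real CARD('n) * c \<le> 1"
    using doubly_stochastic_transition[of W 0 B, OF ds] by (simp add: doubly_stochastic_def)
  moreover have "0 < c" using w(1) by (simp add: c_def)
  moreover have "disagreement (v (s + n)) \<le> (if n = B then 1 - real CARD('n) * c else 1) * disagreement (v s)
           + 2 * (\<Sum>l<n. \<Sum>i\<in>UNIV. norm (e (s + l) i))"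
    if step: "\<And>k i. v (Suc k) i = (\<Sum>j\<in>UNIV. W k $ i $ j *\<^sub>R v k j) + e k i"
    for v :: "nat \<Rightarrow> 'n \<Rightarrow> 'b" and e s n
  proof (cases "n = B")
    case True
    have "c \<le> transition W s n $ i $ j" for i j
      unfolding c_def B_def True by (rule transition_ge[of E W w P, OF self ds w sc])
    from perturbed_disagreement_le[of W v e c s n, OF ds step this] show ?thesis using True by simp
  next
    case False
    \<comment> \<open>The trivial entry bound 0 makes the contraction factor equal to 1.\<close>
    have "0 \<le> transition W s n $ i $ j" for i j
      using doubly_stochastic_transition[of W s n, OF ds] by (simp add: doubly_stochastic_def)
    from perturbed_disagreement_le[of W v e 0 s n, OF ds step this] show ?thesis using False by simp
  qed
  ultimately show ?thesis
    by (intro that[of B "1 - real CARD('n) * c"]) (auto simp: B_def)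
qed

lemma disagreement_le_norms:
  "disagreement v \<le> 2 * (\<Sum>i\<in>UNIV. norm (v i))" for v :: "'n::finite \<Rightarrow> 'b::real_normed_vector"
proof -
  have "disagreement v \<le> (\<Sum>i\<in>UNIV. norm (v i) + norm (mean v))"
    unfolding disagreement_def by (intro sum_mono norm_triangle_ineq4)
  moreover have "real CARD('n) * norm (mean v) \<le> (\<Sum>i\<in>UNIV. norm (v i))"
    using norm_sum[of v UNIV] by (simp add: mean_def field_simps)
  ultimately show ?thesis by (simp add: sum.distrib)
qed

section \<open>Power step sizes and contracting sequences\<close>

lemma powr_neg_shift_le:
  assumes "0 < l" "0 \<le> s"
  shows "(real k + l) powr (- s) \<le> (min 1 l) powr (- s) * (real k + 1) powr (- s)"
proof -
  have "min 1 l * (real k + 1) \<le> real k + l"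
    using assms by (auto simp: min_def distrib_left mult_left_le_one_le)
  then have "(real k + l) powr (- s) \<le> (min 1 l * (real k + 1)) powr (- s)"
    using assms by (intro powr_mono2') (auto simp: mult_pos_pos)
  then show ?thesis using assms by (simp add: powr_mult)
qed

lemma sum_powr_neg_le:
  assumes "0 < s" "s < 1"
  shows "(\<Sum>k<K. (real k + 1) powr (- s)) \<le> real K powr (1 - s) / (1 - s)"
proof (induction K)
  case (Suc K)
  \<comment> \<open>Integral comparison for one term: the mean value theorem for t^(1-s) on
    [K, K+1]. At K = 0 this power has no derivative at the left endpoint, so that case is checked by
    hand.\<close>
  have "(1 - s) * (real K + 1) powr (- s) \<le> (real K + 1) powr (1 - s) - real K powr (1 - s)"
  proof (cases "K = 0")
    case False
    have "\<exists>z>real K. z < real K + 1 \<and> (real K + 1) powr (1 - s) - real K powr (1 - s)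
        = (real K + 1 - real K) * ((1 - s) * z powr (1 - s - 1))"
      using False by (intro MVT2 has_real_derivative_powr) auto
    then obtain z where z: "real K < z" "z < real K + 1"
      "(real K + 1) powr (1 - s) - real K powr (1 - s)
        = (real K + 1 - real K) * ((1 - s) * z powr (1 - s - 1))" by blast
    have "(real K + 1) powr (- s) \<le> z powr (- s)"
      using z assms False by (intro powr_mono2') auto
    then show ?thesis using z(3) assms by simp
  qed (use assms in simp)
  then have "(real K + 1) powr (- s) \<le> ((real K + 1) powr (1 - s) - real K powr (1 - s)) / (1 - s)"
    using assms by (simp add: pos_le_divide_eq mult.commute)
  then show ?case using Suc by (simp add: diff_divide_distrib add.commute)
qed simp

text \<open>Each of the \<open>K\<close> terms is at least ((1 + l) K)^(-s), which already gives the
  right order.\<close>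

lemma sum_powr_neg_ge:
  assumes "0 < l" "0 < s" "1 \<le> K"
  shows "(1 + l) powr (- s) * real K powr (1 - s) \<le> (\<Sum>k<K. (real k + l) powr (- s))"
proof -
  have "(\<Sum>k<K. (1 + l) powr (- s) * real K powr (- s)) \<le> (\<Sum>k<K. (real k + l) powr (- s))"
  proof (rule sum_mono)
    fix k assume "k \<in> {..<K}"
    moreover have "l * 1 \<le> l * real K" using assms by (intro mult_left_mono) auto
    ultimately have "real k + l \<le> (1 + l) * real K" by (simp add: distrib_right)
    then have "((1 + l) * real K) powr (- s) \<le> (real k + l) powr (- s)"
      using assms by (intro powr_mono2') auto
    then show "(1 + l) powr (- s) * real K powr (- s) \<le> (real k + l) powr (- s)"
      using assms by (simp add: powr_mult)
  qed
  also have "(\<Sum>k<K. (1 + l) powr (- s) * real K powr (- s)) = (1 + l) powr (- s) * (real K powr 1 * real K powr (- s))"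
    using assms by simp
  finally show ?thesis by (simp only: powr_add[symmetric]) simp
qed

lemma sum_diff_shift_le:
  fixes g :: "nat \<Rightarrow> real"
  assumes "\<And>k. 0 \<le> g k"
  shows "(\<Sum>k<K. g k - g (k + n)) \<le> (\<Sum>k<n. g k)"
proof -
  have "(\<Sum>k<K. g k) \<le> (\<Sum>k<K + n. g k)" using assms by (intro sum_mono2) auto
  also have "\<dots> = (\<Sum>k<n. g k) + (\<Sum>k<K. g (k + n))"
    by (induction K) (auto simp: add.commute)
  finally show ?thesis by (simp add: sum_subtractf)
qed

text \<open>Neither series converges for s \<le> 1, but a whole shift \<open>n\<close> with l' \<le>
  n + l replaces the second by a shifted copy of the first, and then the first \<open>n\<close>
  terms bound the sum of differences.\<close>

lemma powr_neg_diff_sum_bounded: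
  assumes "0 < l" "0 < l'" "0 \<le> s"
  obtains C where "\<And>K. (\<Sum>k<K. (real k + l) powr (- s) - (real k + l') powr (- s)) \<le> C"
proof
  fix K
  define n where "n = nat \<lceil>\<bar>l' - l\<bar>\<rceil>"
  define g where "g k = (real k + l) powr (- s)" for k
  have n: "l' \<le> real n + l" unfolding n_def by linarith
  have "g (k + n) \<le> (real k + l') powr (- s)" for k
    unfolding g_def using assms n by (intro powr_mono2') auto
  then have "(\<Sum>k<K. g k - (real k + l') powr (- s)) \<le> (\<Sum>k<K. g k - g (k + n))"
    by (intro sum_mono) auto
  also have "\<dots> \<le> (\<Sum>k<n. g k)" by (rule sum_diff_shift_le) (simp add: g_def)
  finally show "(\<Sum>k<K. (real k + l) powr (- s) - (real k + l') powr (- s))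
      \<le> (\<Sum>k<nat \<lceil>\<bar>l' - l\<bar>\<rceil>. (real k + l) powr (- s))" by (simp add: g_def n_def)
qed

text \<open>The player with the smallest \<open>l\<close> attains the maximum at every time, so the
  maximum is itself a shifted power and only two shifts have to be compared.\<close>

lemma Max_powr_neg_diff_sum_bounded:
  fixes l :: "'n::finite \<Rightarrow> real"
  assumes l: "\<And>i. 0 < l i" and s: "0 \<le> s"
  obtains C where "\<And>K. (\<Sum>k<K. Max (range (\<lambda>j. (real k + l j) powr (- s))) - (real k + l i) powr (- s)) \<le> C"
proof -
  have "Min (range l) \<in> range l" by (rule Min_in) auto
  then obtain m where m: "l m = Min (range l)" by (metis imageE)
  then have le: "l m \<le> l j" for j by simp
  have M: "Max (range (\<lambda>j. (real k + l j) powr (- s))) = (real k + l m) powr (- s)" for k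
  proof (rule Max_eqI)
    fix y assume "y \<in> range (\<lambda>j. (real k + l j) powr (- s))"
    then obtain j where "y = (real k + l j) powr (- s)" by blast
    then show "y \<le> (real k + l m) powr (- s)"
      using powr_mono2'[of "- s" "real k + l m" "real k + l j"] s le[of j] l[of m] by simp
  qed auto
  obtain C where "\<And>K. (\<Sum>k<K. (real k + l m) powr (- s) - (real k + l i) powr (- s)) \<le> C"
    using powr_neg_diff_sum_bounded[OF l[of m] l[of i] s] by blast
  then show ?thesis by (intro that[of C]) (simp add: M)
qed

text \<open>The bound is chosen so that t \<mapsto> \<rho> t + c maps it to at most itself; the
  induction descends in steps of \<open>B\<close>.\<close>

lemma contraction_bounded:
  fixes d :: "nat \<Rightarrow> real"
  assumes B: "0 < B" and \<rho>: "0 \<le> \<rho>" "\<rho> < 1" and c: "0 \<le> c"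
    and start: "\<And>k. k < B \<Longrightarrow> d k \<le> D"
    and step: "\<And>k. d (k + B) \<le> \<rho> * d k + c"
  shows "d k \<le> \<bar>D\<bar> + c / (1 - \<rho>)"
proof (induction k rule: less_induct)
  case (less k)
  show ?case
  proof (cases "k < B")
    case True
    then show ?thesis using start[OF True] c \<rho> by (smt (verit) divide_nonneg_pos)
  next
    case False
    then have "d k \<le> \<rho> * d (k - B) + c" using step[of "k - B"] by simp
    also have "\<dots> \<le> \<rho> * (\<bar>D\<bar> + c / (1 - \<rho>)) + c"
      using less[of "k - B"] False B \<rho> by (intro add_right_mono mult_left_mono) auto
    also have "\<dots> = \<rho> * \<bar>D\<bar> + c / (1 - \<rho>)"
      using \<rho> by (simp add: field_simps)
    also have "\<rho> * \<bar>D\<bar> \<le> \<bar>D\<bar>" using \<rho> by (simp add: mult_left_le_one_le)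
    finally show ?thesis by simp
  qed
qed

text \<open>Shift the weighted sum by \<open>B\<close>: as the weights decrease, the sum S satisfies
  S \<le> const + \<rho> S + c B \<Sum> \<gamma>^2, and this inequality between finite numbers is
  solved for S.\<close>

lemma weighted_contraction_sum_bounded:
  fixes d \<gamma> :: "nat \<Rightarrow> real"
  assumes B: "0 < B" and \<rho>: "0 \<le> \<rho>" "\<rho> < 1" and c: "0 \<le> c"
    and d: "\<And>k. 0 \<le> d k" and \<gamma>: "\<And>k. 0 \<le> \<gamma> k" "antimono \<gamma>"
    and sq: "summable (\<lambda>k. (\<gamma> k)\<^sup>2)"
    and step: "\<And>k. d (k + B) \<le> \<rho> * d k + c * (\<Sum>l<B. \<gamma> (k + l))"
  obtains C where "\<And>K. (\<Sum>k<K. \<gamma> k * d k) \<le> C"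
proof
  fix K
  let ?S = "\<lambda>K. \<Sum>k<K. \<gamma> k * d k"
  have "?S K \<le> ?S (B + K)"
    using d \<gamma> by (intro sum_mono2) auto
  also have "\<dots> = ?S B + (\<Sum>k<K. \<gamma> (k + B) * d (k + B))"
    by (induction K) (auto simp: add.commute)
  also have "(\<Sum>k<K. \<gamma> (k + B) * d (k + B)) \<le> (\<Sum>k<K. \<rho> * (\<gamma> k * d k) + c * real B * (\<gamma> k)\<^sup>2)"
  proof (rule sum_mono)
    fix k
    have "\<gamma> (k + B) * d (k + B) \<le> \<gamma> k * (\<rho> * d k + c * (\<Sum>l<B. \<gamma> k))"
    proof (rule mult_mono)
      have "(\<Sum>l<B. \<gamma> (k + l)) \<le> (\<Sum>l<B. \<gamma> k)"
        by (intro sum_mono antimonoD[OF \<gamma>(2)]) simp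
      then show "d (k + B) \<le> \<rho> * d k + c * (\<Sum>l<B. \<gamma> k)"
        using step[of k] c by (smt (verit) mult_left_mono)
    qed (use d \<gamma> antimonoD[OF \<gamma>(2), of k "k + B"] in auto)
    then show "\<gamma> (k + B) * d (k + B) \<le> \<rho> * (\<gamma> k * d k) + c * real B * (\<gamma> k)\<^sup>2"
      by (simp add: algebra_simps power2_eq_square)
  qed
  also have "\<dots> \<le> \<rho> * ?S K + c * real B * (\<Sum>k. (\<gamma> k)\<^sup>2)"
    using sum_le_suminf[OF sq, of "{..<K}"] c
    by (simp add: sum.distrib flip: sum_distrib_left) (simp add: mult_left_mono)
  finally have "(1 - \<rho>) * ?S K \<le> ?S B + c * real B * (\<Sum>k. (\<gamma> k)\<^sup>2)"
    by (simp add: algebra_simps)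
  then show "?S K \<le> (?S B + c * real B * (\<Sum>k. (\<gamma> k)\<^sup>2)) / (1 - \<rho>)"
    using \<rho> by (simp add: field_simps)
qed

text \<open>Lets all players be compared with one reference sequence; the sum of the individual
  constants dominates each of them.\<close>

lemma powr_neg_family_le:
  fixes l :: "'n::finite \<Rightarrow> real"
  assumes l: "\<And>i. 0 < l i" and s: "0 \<le> s"
  obtains C where "0 < C" "\<And>i k. (real k + l i) powr (- s) \<le> C * (real k + 1) powr (- s)"
proof
  let ?C = "\<Sum>i\<in>UNIV. (min 1 (l i)) powr (- s)"
  show "0 < ?C" by (rule sum_pos) (use l in \<open>auto simp: min_def less_imp_neq[symmetric]\<close>)
  fix i k
  have "(min 1 (l i)) powr (- s) \<le> ?C" by (rule member_le_sum) auto
  then show "(real k + l i) powr (- s) \<le> ?C * (real k + 1) powr (- s)"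
    by (rule order_trans[OF powr_neg_shift_le[OF l s] mult_right_mono]) simp
qed

section \<open>Gradients on coordinate subspaces\<close>

text \<open>A derivative within \<open>E\<close> is tested only on differences of points of
  \<open>E\<close>, so its values off \<open>E\<close> may be changed.\<close>

lemma has_derivative_cong_on_subspace:
  assumes D: "(g has_derivative T) (at x within E)" and E: "subspace E" "x \<in> E"
    and T': "bounded_linear T'" and eq: "\<And>u. u \<in> E \<Longrightarrow> T' u = T u"
  shows "(g has_derivative T') (at x within E)"
  unfolding has_derivative_within
proof
  have "((\<lambda>y. (1 / norm (y - x)) *\<^sub>R (g y - (g x + T (y - x)))) \<longlongrightarrow> 0) (at x within E)"
    using D by (simp add: has_derivative_within)
  moreover have "T' (y - x) = T (y - x)" if "y \<in> E" for y
    using that E by (intro eq subspace_diff)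
  ultimately show "((\<lambda>y. (1 / norm (y - x)) *\<^sub>R (g y - (g x + T' (y - x)))) \<longlongrightarrow> 0) (at x within E)"
    by (auto elim!: Lim_transform_eventually simp: eventually_at_filter)
qed fact

text \<open>Replaces the definite description by an explicit vector of values
  \<open>T (axis c 1)\<close>, through which continuity of the derivative passes to the
  gradient.\<close>

lemma grad_on_coordinates:
  fixes g :: "real^'m::finite \<Rightarrow> real"
  assumes E: "E = {x. \<forall>c. c \<notin> S \<longrightarrow> x $ c = 0}" and x: "x \<in> E"
    and D: "(g has_derivative T) (at x within E)"
  shows "grad_on E g x = (\<chi> c. if c \<in> S then T (axis c 1) else 0)"
proof (rule grad_on_unique)
  let ?v = "(\<chi> c. if c \<in> S then T (axis c 1) else 0) :: real^'m"
  show sub: "subspace E" by (auto simp: E subspace_def)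
  show "?v \<in> E" by (simp add: E)
  have lin: "linear T" using D has_derivative_linear by blast
  have "?v \<bullet> u = T u" if "u \<in> E" for u
  proof -
    have "T u = T (\<Sum>c\<in>UNIV. u $ c *\<^sub>R axis c 1)"
      using basis_expansion[of u] by (simp add: scalar_mult_eq_scaleR)
    also have "\<dots> = (\<Sum>c\<in>UNIV. u $ c * T (axis c 1))"
      by (simp add: linear_sum[OF lin] linear_scale[OF lin])
    also have "\<dots> = (\<Sum>c\<in>UNIV. ?v $ c * u $ c)"
      using that by (intro sum.cong) (auto simp: E)
    finally show ?thesis by (simp add: inner_vec_def)
  qed
  then show "(g has_derivative (\<lambda>u. ?v \<bullet> u)) (at x within E)"
    by (intro has_derivative_cong_on_subspace[OF D sub x] bounded_linear_inner_right) auto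
qed fact

text \<open>Continuity will bound \<open>F\<close> on compact sets; membership in the block ensures
  that pairing with \<open>F\<close> sees only the player's own coordinates.\<close>

lemma continuous_on_aggr_grad:
  fixes h :: "real^'m::finite \<Rightarrow> real^'l::finite" and own :: "'m \<Rightarrow> 'n" and i :: 'n
  defines "B \<equiv> block own i"
  assumes h: "cont_diff_on B B h"
    and g: "cont_diff_on (B \<times> UNIV) U (\<lambda>(u, s). g u s)"
    and X: "X \<subseteq> B" "X \<times> UNIV \<subseteq> U"
  shows "continuous_on (X \<times> UNIV) (\<lambda>(u, z). aggr_grad B h g u z)"
    and "u \<in> X \<Longrightarrow> aggr_grad B h g u z \<in> B"
proof -
  obtain Dh where Dh: "continuous_on B Dh"
    "\<And>u. u \<in> B \<Longrightarrow> (h has_derivative blinfun_apply (Dh u)) (at u within B)"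
    using h by (auto simp: cont_diff_on_def)
  obtain D where D: "continuous_on U D"
    "\<And>p. p \<in> U \<Longrightarrow> ((\<lambda>(u, s). g u s) has_derivative blinfun_apply (D p)) (at p within B \<times> UNIV)"
    using g by (auto simp: cont_diff_on_def)
  have B: "B = {x. \<forall>c. c \<notin> {c. own c = i} \<longrightarrow> x $ c = 0}" by (auto simp: B_def block_def)
  have h': "grad_on B (\<lambda>y. h y $ l) u = (\<chi> c. if own c = i then Dh u (axis c 1) $ l else 0)"
    if u: "u \<in> B" for u l
    using grad_on_coordinates[OF B u bounded_linear.has_derivative[OF bounded_linear_vec_nth Dh(2)[OF u]]]
    by simp
  have g1: "grad_on B (\<lambda>u. g u z) u = (\<chi> c. if own c = i then D (u, z) (axis c 1, 0) else 0)"
    if u: "u \<in> X" for u z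
  proof -
    \<comment> \<open>Partial gradients come from the joint derivative along a slice through the
      point.\<close>
    have 1: "((\<lambda>u. (u, z)) has_derivative (\<lambda>u. (u, 0))) (at u within B)"
      by (auto intro!: derivative_eq_intros)
    have 2: "((\<lambda>(u, s). g u s) has_derivative blinfun_apply (D (u, z))) (at (u, z) within (\<lambda>u. (u, z)) ` B)"
      by (rule has_derivative_subset[OF D(2)]) (use u X in auto)
    show ?thesis
      using grad_on_coordinates[OF B _ has_derivative_in_compose[OF 1 2]] u X by auto
  qed
  have g2: "grad_on UNIV (\<lambda>s. g u s) z = (\<chi> c. D (u, z) (0, axis c 1))"
    if u: "u \<in> X" for u z
  proof -
    have 1: "((\<lambda>s. (u, s)) has_derivative (\<lambda>s. (0, s))) (at z)"
      by (auto intro!: derivative_eq_intros)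
    have 2: "((\<lambda>(u, s). g u s) has_derivative blinfun_apply (D (u, z))) (at (u, z) within range (\<lambda>s. (u, s)))"
      by (rule has_derivative_subset[OF D(2)]) (use u X in auto)
    show ?thesis
      using grad_on_coordinates[of UNIV UNIV z, OF _ _ has_derivative_in_compose[OF 1 2]] by simp
  qed
  \<comment> \<open>The same map written with directional derivatives and defined on all pairs;
    continuity is read off here and transferred on \<open>X \<times> UNIV\<close>.\<close>
  define G where "G p = (\<chi> c. (if own c = i then D p (axis c 1, 0) else 0)
      + (\<Sum>l\<in>UNIV. (if own c = i then Dh (fst p) (axis c 1) $ l else 0) * D p (0, axis l 1)))" for p
  have "continuous_on (X \<times> UNIV) (\<lambda>p. Dh (fst p))"
    by (rule continuous_on_compose2[OF Dh(1)]) (use X in \<open>auto intro!: continuous_intros\<close>)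
  moreover have "continuous_on (X \<times> UNIV) D"
    using D(1) X(2) by (rule continuous_on_subset)
  ultimately have *: "continuous_on (X \<times> UNIV) (\<lambda>p. D p w)" "continuous_on (X \<times> UNIV) (\<lambda>p. Dh (fst p) w')"
    for w w' by (auto intro!: continuous_intros)
  have "continuous_on (X \<times> UNIV) G"
    unfolding G_def
  proof (rule continuous_on_vec_lambda)
    fix c
    show "continuous_on (X \<times> UNIV) (\<lambda>p. (if own c = i then D p (axis c 1, 0) else 0)
      + (\<Sum>l\<in>UNIV. (if own c = i then Dh (fst p) (axis c 1) $ l else 0) * D p (0, axis l 1)))"
      by (cases "own c = i") (auto intro!: continuous_intros *)
  qed
  moreover have G: "G p = (\<lambda>(u, z). aggr_grad B h g u z) p" if "p \<in> X \<times> UNIV" for p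
    using that X g1 g2 h'
    by (auto simp: G_def aggr_grad_def transp_jacobian_on_def matrix_vector_mult_def vec_eq_iff subset_iff)
  ultimately show "continuous_on (X \<times> UNIV) (\<lambda>(u, z). aggr_grad B h g u z)"
    by (rule continuous_on_eq)
  have "G p \<in> B" for p by (auto simp: B G_def)
  then show "u \<in> X \<Longrightarrow> aggr_grad B h g u z \<in> B" using G[of "(u, z)"] by (metis case_prod_conv mem_Sigma_iff UNIV_I)
qed

lemma bounded_linear_player_part: "bounded_linear (player_part own i)"
  by (intro linear_conv_bounded_linear[THEN iffD1] linearI) (auto simp: player_part_def vec_eq_iff)

lemma sum_player_part: "(\<Sum>i\<in>UNIV. player_part own i y) = y"
  for own :: "'m::finite \<Rightarrow> 'n::finite"
  by (simp add: vec_eq_iff player_part_def)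

lemma inner_player_part: "w \<in> block own i \<Longrightarrow> w \<bullet> player_part own i y = w \<bullet> y"
  by (auto simp: block_def player_part_def inner_vec_def intro!: sum.cong)

lemma norm_add3_squared_le:
  fixes u v w :: "'a::real_inner"
  assumes "norm u \<le> p" "norm w \<le> q"
  shows "(norm (u + v + w))\<^sup>2 \<le> 3 * (p\<^sup>2 + (norm v)\<^sup>2 + q\<^sup>2)"
proof -
  have "norm (u + v + w) \<le> p + norm v + q"
    using assms norm_triangle_ineq[of "u + v" w] norm_triangle_ineq[of u v] by linarith
  then have "(norm (u + v + w))\<^sup>2 \<le> (p + norm v + q)\<^sup>2" by (rule power_mono) simp
  also have "\<dots> \<le> 3 * (p\<^sup>2 + (norm v)\<^sup>2 + q\<^sup>2)"
    using sum_squares_bound[of p "norm v"] sum_squares_bound[of p q] sum_squares_bound[of "norm v" q]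
    by (simp add: power2_eq_square algebra_simps)
  finally show ?thesis .
qed

section \<open>Martingale noise\<close>

lemma borel_measurable_vec_nth [measurable (raw)]:
  fixes f :: "'a \<Rightarrow> real^'m::finite"
  assumes "f \<in> borel_measurable M"
  shows "(\<lambda>x. f x $ c) \<in> borel_measurable M"
  by (rule measurable_compose[OF assms borel_measurable_continuous_onI])
     (intro continuous_on_component continuous_on_id)

text \<open>Worked out with nonnegative integrals first, because integrability of the square is a
  conclusion; the conditional bound is integrated against the constant 1.\<close>

lemma (in prob_space) second_moment_le:
  fixes Z :: "'a \<Rightarrow> 'b::euclidean_space"
  assumes H: "subalgebra M H" and Z: "Z \<in> borel_measurable M"
    and var: "AE \<omega> in M. nn_cond_exp M H (\<lambda>\<omega>. ennreal ((norm (Z \<omega>))\<^sup>2)) \<omega> \<le> ennreal (s\<^sup>2)"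
  shows "integrable M (\<lambda>\<omega>. (norm (Z \<omega>))\<^sup>2)" "(\<integral>\<omega>. (norm (Z \<omega>))\<^sup>2 \<partial>M) \<le> s\<^sup>2"
proof -
  interpret finite_measure_subalgebra M H by unfold_locales (rule H)
  have [measurable]: "Z \<in> borel_measurable M" by (rule Z)
  have "(\<integral>\<^sup>+\<omega>. ennreal ((norm (Z \<omega>))\<^sup>2) \<partial>M)
      = (\<integral>\<^sup>+\<omega>. 1 * nn_cond_exp M H (\<lambda>\<omega>. ennreal ((norm (Z \<omega>))\<^sup>2)) \<omega> \<partial>M)"
    by (subst nn_cond_exp_intg) auto
  also have "\<dots> \<le> (\<integral>\<^sup>+\<omega>. ennreal (s\<^sup>2) \<partial>M)"
    by (intro nn_integral_mono_AE) (use var in simp)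
  finally have le: "(\<integral>\<^sup>+\<omega>. ennreal ((norm (Z \<omega>))\<^sup>2) \<partial>M) \<le> ennreal (s\<^sup>2)"
    by (simp add: emeasure_space_1)
  show "integrable M (\<lambda>\<omega>. (norm (Z \<omega>))\<^sup>2)"
    by (rule integrableI_bounded) (use le in \<open>auto intro: le_less_trans\<close>)
  show "(\<integral>\<omega>. (norm (Z \<omega>))\<^sup>2 \<partial>M) \<le> s\<^sup>2"
    by (rule integral_real_bounded) (use le in auto)
qed

text \<open>\<open>Y\<close> is known given \<open>H\<close>, so it can be taken out of the
  conditional expectation coordinate by coordinate; square integrability of both factors makes the
  products integrable.\<close>

lemma (in prob_space) integral_inner_cond_mean_zero:
  fixes Y Z :: "'a \<Rightarrow> real^'m::finite"
  assumes H: "subalgebra M H" and Y: "Y \<in> borel_measurable H" and Z: "Z \<in> borel_measurable M"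
    and sq: "integrable M (\<lambda>\<omega>. (norm (Y \<omega>))\<^sup>2)" "integrable M (\<lambda>\<omega>. (norm (Z \<omega>))\<^sup>2)"
    and mean0: "\<And>c. AE \<omega> in M. real_cond_exp M H (\<lambda>\<omega>. Z \<omega> $ c) \<omega> = 0"
  shows "integrable M (\<lambda>\<omega>. Y \<omega> \<bullet> Z \<omega>)" "(\<integral>\<omega>. Y \<omega> \<bullet> Z \<omega> \<partial>M) = 0"
proof -
  interpret finite_measure_subalgebra M H by unfold_locales (rule H)
  have [measurable]: "Z \<in> borel_measurable M" "Y \<in> borel_measurable H" by fact+
  have [measurable]: "Y \<in> borel_measurable M" by (rule measurable_from_subalg[OF H Y])
  have int: "integrable M (\<lambda>\<omega>. Y \<omega> $ c * Z \<omega> $ c)" for c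
  proof (rule Bochner_Integration.integrable_bound[OF Bochner_Integration.integrable_add[OF sq]])
    show "AE \<omega> in M. norm (Y \<omega> $ c * Z \<omega> $ c) \<le> norm ((norm (Y \<omega>))\<^sup>2 + (norm (Z \<omega>))\<^sup>2)"
    proof (rule AE_I2)
      fix \<omega>
      have "\<bar>Y \<omega> $ c * Z \<omega> $ c\<bar> \<le> norm (Y \<omega>) * norm (Z \<omega>)"
        unfolding abs_mult by (intro mult_mono component_le_norm_cart) auto
      also have "\<dots> \<le> (norm (Y \<omega>))\<^sup>2 + (norm (Z \<omega>))\<^sup>2"
        using sum_squares_bound[of "norm (Y \<omega>)" "norm (Z \<omega>)"]
          mult_nonneg_nonneg[OF norm_ge_zero norm_ge_zero, of "Y \<omega>" "Z \<omega>"] by linarith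
      finally show "norm (Y \<omega> $ c * Z \<omega> $ c) \<le> norm ((norm (Y \<omega>))\<^sup>2 + (norm (Z \<omega>))\<^sup>2)" by simp
    qed
  qed measurable
  have "(\<integral>\<omega>. Y \<omega> $ c * Z \<omega> $ c \<partial>M) = 0" for c
  proof -
    have "(\<integral>\<omega>. Y \<omega> $ c * Z \<omega> $ c \<partial>M)
        = (\<integral>\<omega>. Y \<omega> $ c * real_cond_exp M H (\<lambda>\<omega>. Z \<omega> $ c) \<omega> \<partial>M)"
      by (rule real_cond_exp_intg(2)[symmetric]) (auto intro: int)
    also have "\<dots> = (\<integral>\<omega>. 0 \<partial>M)"
      by (rule integral_cong_AE) (use mean0[of c] in auto)
    finally show ?thesis by simp
  qed
  then show "integrable M (\<lambda>\<omega>. Y \<omega> \<bullet> Z \<omega>)" "(\<integral>\<omega>. Y \<omega> \<bullet> Z \<omega> \<partial>M) = 0"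
    using int by (simp_all add: inner_vec_def)
qed

text \<open>The sum of the terms before \<open>K\<close> is \<open>H K\<close>-measurable, so its
  cross term with the next increment has mean zero and second moments add.\<close>

lemma (in prob_space) martingale_second_moment:
  fixes Z :: "nat \<Rightarrow> 'a \<Rightarrow> real^'m::finite"
  assumes H: "\<And>k. subalgebra M (H k)" and Z: "\<And>k. Z k \<in> borel_measurable M"
    and adapted: "\<And>l k. l < k \<Longrightarrow> Z l \<in> borel_measurable (H k)"
    and sq: "\<And>k. integrable M (\<lambda>\<omega>. (norm (Z k \<omega>))\<^sup>2)" "\<And>k. (\<integral>\<omega>. (norm (Z k \<omega>))\<^sup>2 \<partial>M) \<le> s"
    and mean0: "\<And>k c. AE \<omega> in M. real_cond_exp M (H k) (\<lambda>\<omega>. Z k \<omega> $ c) \<omega> = 0"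
  shows "integrable M (\<lambda>\<omega>. (norm (\<Sum>k<K. a k *\<^sub>R Z k \<omega>))\<^sup>2) \<and>
    (\<integral>\<omega>. (norm (\<Sum>k<K. a k *\<^sub>R Z k \<omega>))\<^sup>2 \<partial>M) \<le> s * (\<Sum>k<K. (a k)\<^sup>2)"
proof (induction K)
  case (Suc K)
  let ?S = "\<lambda>\<omega>. \<Sum>k<K. a k *\<^sub>R Z k \<omega>"
  have S: "?S \<in> borel_measurable (H K)"
    using adapted by (intro borel_measurable_sum borel_measurable_scaleR) auto
  note orth = integral_inner_cond_mean_zero[OF H S Z conjunct1[OF Suc] sq(1) mean0]
  have eq: "(norm (\<Sum>k<Suc K. a k *\<^sub>R Z k \<omega>))\<^sup>2
      = (norm (?S \<omega>))\<^sup>2 + 2 * a K * (?S \<omega> \<bullet> Z K \<omega>) + (a K)\<^sup>2 * (norm (Z K \<omega>))\<^sup>2" for \<omega>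
    unfolding power2_norm_eq_inner
    by (simp add: inner_add_left inner_add_right inner_commute algebra_simps power2_eq_square)
  have "(a K)\<^sup>2 * (\<integral>\<omega>. (norm (Z K \<omega>))\<^sup>2 \<partial>M) \<le> (a K)\<^sup>2 * s"
    by (intro mult_left_mono sq) auto
  then show ?case
    unfolding eq using Suc orth sq(1) by (simp add: algebra_simps)
qed simp

text \<open>The crude inequality |t| \<le> 1 + t^2 takes the place of Jensen; only boundedness is
  wanted.\<close>

lemma (in prob_space) integral_le_1_plus_square:
  fixes Y :: "'a \<Rightarrow> real"
  assumes Y: "Y \<in> borel_measurable M" and sq: "integrable M (\<lambda>\<omega>. (Y \<omega>)\<^sup>2)"
  shows "integrable M Y" "(\<integral>\<omega>. Y \<omega> \<partial>M) \<le> 1 + (\<integral>\<omega>. (Y \<omega>)\<^sup>2 \<partial>M)"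
proof -
  have le: "\<bar>t\<bar> \<le> 1 + t\<^sup>2" for t :: real
    using sum_squares_bound[of 1 "\<bar>t\<bar>"] by simp
  show int: "integrable M Y"
    by (rule Bochner_Integration.integrable_bound[of M "\<lambda>\<omega>. 1 + (Y \<omega>)\<^sup>2"])
       (use le Y sq in \<open>auto intro: order_trans[OF le]\<close>)
  have "(\<integral>\<omega>. Y \<omega> \<partial>M) \<le> (\<integral>\<omega>. 1 + (Y \<omega>)\<^sup>2 \<partial>M)"
    using int sq le by (intro integral_mono) (auto intro: order_trans[OF abs_ge_self])
  then show "(\<integral>\<omega>. Y \<omega> \<partial>M) \<le> 1 + (\<integral>\<omega>. (Y \<omega>)\<^sup>2 \<partial>M)"
    using sq by (simp add: prob_space)
qed

lemma sets_history:
  "sets (history M x0 \<zeta> k) = sigma_sets (space M)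
     ({x0 -` B \<inter> space M |B. B \<in> sets borel} \<union>
      {\<zeta> i l -` B \<inter> space M |i l B. l < k \<and> B \<in> sets borel})"
  unfolding history_def by (rule sets_measure_of) blast

lemma space_history: "space (history M x0 \<zeta> k) = space M"
  unfolding history_def by (rule space_measure_of) blast

lemma subalgebra_history:
  assumes "x0 \<in> borel_measurable M" "\<And>i l. \<zeta> i l \<in> borel_measurable M"
  shows "subalgebra M (history M x0 \<zeta> k)"
proof -
  have "sets (history M x0 \<zeta> k) \<subseteq> sets M"
    unfolding sets_history
    by (rule sets.sigma_sets_subset)
       (use measurable_sets[OF assms(1)] measurable_sets[OF assms(2)] in blast)
  then show ?thesis by (simp add: subalgebra_def space_history)
qed

lemma
  fixes x0 :: "'a \<Rightarrow> 'b::topological_space" and \<zeta> :: "'c \<Rightarrow> nat \<Rightarrow> 'a \<Rightarrow> 'd::topological_space"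
  shows x0_measurable_history: "x0 \<in> borel_measurable (history M x0 \<zeta> k)"
    and noise_measurable_history: "l < k \<Longrightarrow> \<zeta> i l \<in> borel_measurable (history M x0 \<zeta> k)"
    and subalgebra_history_mono: "k \<le> k' \<Longrightarrow> subalgebra (history M x0 \<zeta> k') (history M x0 \<zeta> k)"
proof -
  let ?G = "\<lambda>k. {x0 -` B \<inter> space M |B. B \<in> sets borel} \<union>
      {\<zeta> i l -` B \<inter> space M |i l B. l < k \<and> B \<in> sets borel}"
  show "x0 \<in> borel_measurable (history M x0 \<zeta> k)"
  proof (rule measurableI)
    fix A :: "'b set" assume "A \<in> sets borel"
    then have "x0 -` A \<inter> space M \<in> ?G k" by blast
    then show "x0 -` A \<inter> space (history M x0 \<zeta> k) \<in> sets (history M x0 \<zeta> k)"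
      unfolding sets_history space_history by (rule sigma_sets.Basic)
  qed simp
  show "\<zeta> i l \<in> borel_measurable (history M x0 \<zeta> k)" if "l < k"
  proof (rule measurableI)
    fix A :: "'d set" assume "A \<in> sets borel"
    then have "\<zeta> i l -` A \<inter> space M \<in> ?G k" using that by blast
    then show "\<zeta> i l -` A \<inter> space (history M x0 \<zeta> k) \<in> sets (history M x0 \<zeta> k)"
      unfolding sets_history space_history by (rule sigma_sets.Basic)
  qed simp
  assume k: "k \<le> k'"
  have "?G k \<subseteq> ?G k'"
  proof (intro Un_mono subset_refl subsetI)
    fix A assume "A \<in> {\<zeta> i l -` B \<inter> space M |i l B. l < k \<and> B \<in> sets borel}"
    then obtain i l B where "A = \<zeta> i l -` B \<inter> space M" "l < k'" "B \<in> sets borel"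
      using k less_le_trans by blast
    then show "A \<in> {\<zeta> i l -` B \<inter> space M |i l B. l < k' \<and> B \<in> sets borel}" by blast
  qed
  then show "subalgebra (history M x0 \<zeta> k') (history M x0 \<zeta> k)"
    by (simp add: subalgebra_def sets_history space_history sigma_sets_mono')
qed

text \<open>\<open>G\<close> is continuous on \<open>A\<close> only, so it is cut off by the
  indicator of \<open>A\<close>. Applied to \<open>h\<close> and \<open>F\<close>, whose arguments
  stay in the strategy sets.\<close>

lemma borel_measurable_continuous_compose:
  fixes g :: "'a \<Rightarrow> 'b::topological_space" and G :: "'b \<Rightarrow> 'c::real_normed_vector"
  assumes g: "g \<in> borel_measurable N" and A: "A \<in> sets borel" "continuous_on A G"
    and gA: "\<And>\<omega>. \<omega> \<in> space N \<Longrightarrow> g \<omega> \<in> A"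
  shows "(\<lambda>\<omega>. G (g \<omega>)) \<in> borel_measurable N"
proof -
  have "(\<lambda>\<omega>. indicat_real A (g \<omega>) *\<^sub>R G (g \<omega>)) \<in> borel_measurable N"
    by (rule measurable_compose[OF g borel_measurable_continuous_on_indicator[OF A]])
  then show ?thesis
    by (rule measurable_cong[THEN iffD1, rotated]) (use gA in simp)
qed

section \<open>The gap function\<close>

lemma gap_le:
  assumes "X \<noteq> {}" "\<And>y. y \<in> X \<Longrightarrow> (x - y) \<bullet> \<phi> y \<le> c"
  shows "gap X \<phi> x \<le> c"
  unfolding gap_def using assms by (rule cSUP_least)

text \<open>A supremum of affine functions with slopes bounded by \<open>C\<close> is Lipschitz.
  This makes the gap of the random average measurable although the supremum may run over an
  uncountable set.\<close>

lemma gap_bounds: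
  assumes X: "X \<noteq> {}" "\<And>y. y \<in> X \<Longrightarrow> norm y \<le> R" and \<phi>: "\<And>y. y \<in> X \<Longrightarrow> norm (\<phi> y) \<le> C"
  shows "\<bar>gap X \<phi> x\<bar> \<le> C * (norm x + R)" "C-lipschitz_on UNIV (gap X \<phi>)"
proof -
  obtain y0 where y0: "y0 \<in> X" using X by blast
  have C: "0 \<le> C" using \<phi>[OF y0] norm_ge_zero order_trans by blast
  have b: "\<bar>(x - y) \<bullet> \<phi> y\<bar> \<le> C * (norm x + R)" if "y \<in> X" for x y
  proof -
    have "\<bar>(x - y) \<bullet> \<phi> y\<bar> \<le> norm (x - y) * norm (\<phi> y)" by (rule Cauchy_Schwarz_ineq2)
    also have "\<dots> \<le> (norm x + R) * C"
      using X(2)[OF that] \<phi>[OF that] norm_triangle_ineq4[of x y]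
        norm_ge_zero[of x] norm_ge_zero[of y] norm_ge_zero[of "\<phi> y"] by (intro mult_mono) linarith+
    finally show ?thesis by (simp add: mult.commute)
  qed
  have bdd: "bdd_above ((\<lambda>y. (x - y) \<bullet> \<phi> y) ` X)" for x
    using b by (intro bdd_aboveI2[where M = "C * (norm x + R)"]) (fastforce simp: abs_le_iff)
  have ge: "(x - y) \<bullet> \<phi> y \<le> gap X \<phi> x" if "y \<in> X" for x y
    unfolding gap_def by (rule cSUP_upper[OF that bdd])
  have "gap X \<phi> x \<le> C * (norm x + R)"
    by (rule gap_le[OF X(1)]) (use b in \<open>fastforce simp: abs_le_iff\<close>)
  moreover have "- (C * (norm x + R)) \<le> gap X \<phi> x"
    using b[OF y0, of x] ge[OF y0, of x] by linarith
  ultimately show "\<bar>gap X \<phi> x\<bar> \<le> C * (norm x + R)" by linarith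
  have half: "gap X \<phi> x \<le> gap X \<phi> x' + C * dist x x'" for x x'
  proof (rule gap_le[OF X(1)])
    fix y assume y: "y \<in> X"
    have "(x - x') \<bullet> \<phi> y \<le> norm (x - x') * norm (\<phi> y)" by (rule norm_cauchy_schwarz)
    also have "\<dots> \<le> norm (x - x') * C" by (intro mult_left_mono \<phi> y) auto
    finally show "(x - y) \<bullet> \<phi> y \<le> gap X \<phi> x' + C * dist x x'"
      using ge[OF y, of x'] by (simp add: inner_diff_left dist_norm mult.commute)
  qed
  show "C-lipschitz_on UNIV (gap X \<phi>)"
  proof (rule lipschitz_onI)
    fix x x'
    show "dist (gap X \<phi> x) (gap X \<phi> x') \<le> C * dist x x'"
      using half[of x x'] half[of x' x] by (simp add: dist_real_def dist_commute abs_le_iff)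
  qed (rule C)
qed

section \<open>Gradient tracking dynamics\<close>

text \<open>The sampled gradient enters as \<open>F\<close> plus \<zeta>, which separates a map with
  pathwise bounds from conditionally centred noise.\<close>

locale tracking_dynamics = prob_space M for M :: "'w measure" +
  fixes own :: "'m::finite \<Rightarrow> 'n::finite"
    and X :: "'n \<Rightarrow> (real^'m) set"
    and h :: "'n \<Rightarrow> real^'m \<Rightarrow> real^'m"
    and F :: "'n \<Rightarrow> real^'m \<Rightarrow> real^'m \<Rightarrow> real^'m"
    and Lh \<upsilon> lam \<delta> :: "'n \<Rightarrow> real"
    and E :: "nat \<Rightarrow> ('n \<times> 'n) set"
    and W :: "nat \<Rightarrow> real^'n^'n"
    and wmin a b :: real
    and P :: nat
    and x :: "nat \<Rightarrow> 'w \<Rightarrow> real^'m"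
    and v :: "nat \<Rightarrow> 'n \<Rightarrow> 'w \<Rightarrow> real^'m"
    and \<zeta> :: "'n \<Rightarrow> nat \<Rightarrow> 'w \<Rightarrow> real^'m"
    and \<alpha> \<eta> :: "'n \<Rightarrow> nat \<Rightarrow> real"
    and v_hat :: "nat \<Rightarrow> 'n \<Rightarrow> 'w \<Rightarrow> real^'m"
    and \<sigma> \<phi> :: "real^'m \<Rightarrow> real^'m"
    and XX :: "(real^'m) set"
  defines "\<alpha> \<equiv> (\<lambda>i k. (real k + lam i) powr (-a))"
    and "\<eta> \<equiv> (\<lambda>i k. (real k + \<delta> i) powr (-b))"
    and "v_hat \<equiv> (\<lambda>k i \<omega>. \<Sum>j\<in>UNIV. (W k $ i $ j) *\<^sub>R v k j \<omega>)"
    and "\<sigma> \<equiv> (\<lambda>y. \<Sum>j\<in>UNIV. h j (player_part own j y))"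
    and "\<phi> \<equiv> (\<lambda>y. \<Sum>i\<in>UNIV. F i (player_part own i y) (\<sigma> y))"
    and "XX \<equiv> {y. \<forall>i. player_part own i y \<in> X i}"
  assumes X: "\<And>i. compact (X i)" "\<And>i. convex (X i)"
    and h_lipschitz: "\<And>i. (Lh i)-lipschitz_on (X i) (h i)"
    and F_continuous: "\<And>i. continuous_on (X i \<times> UNIV) (\<lambda>(u, z). F i u z)"
    and F_block: "\<And>i u z. u \<in> X i \<Longrightarrow> F i u z \<in> block own i"
    and F_lipschitz: "\<And>i c. c > 0 \<Longrightarrow> \<exists>Lf. \<forall>u\<in>X i. \<forall>z1 z2. norm z1 \<le> c \<and> norm z2 \<le> c \<longrightarrow>
           norm (F i u z1 - F i u z2) \<le> Lf * norm (z1 - z2)"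
    and \<phi>_monotone: "\<And>y y'. y \<in> XX \<Longrightarrow> y' \<in> XX \<Longrightarrow> (\<phi> y - \<phi> y') \<bullet> (y - y') \<ge> 0"
    and self_loops: "\<And>k i. (i, i) \<in> E k"
    and W_stochastic: "\<And>k. doubly_stochastic (W k)"
    and wmin: "0 < wmin" "\<And>k i j. (j, i) \<in> E k \<Longrightarrow> wmin \<le> W k $ i $ j"
    and connected: "\<And>k. strongly_connected
           (with_proj \<lparr>pverts = UNIV, parcs = (\<Union>l\<in>{1..P}. E (k + l))\<rparr>)"
    and lam_pos: "\<And>i. lam i > 0"
    and \<delta>_pos: "\<And>i. \<delta> i > 0"
    and exponents: "1 / 2 < a" "b > 0" "a + b < 1"
    and x_0: "x 0 \<in> borel_measurable M" "\<And>i \<omega>. \<omega> \<in> space M \<Longrightarrow> player_part own i (x 0 \<omega>) \<in> X i"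
    and v_0: "\<And>i \<omega>. \<omega> \<in> space M \<Longrightarrow> v 0 i \<omega> = h i (player_part own i (x 0 \<omega>))"
    and x_step: "\<And>k i \<omega>. \<omega> \<in> space M \<Longrightarrow> player_part own i (x (Suc k) \<omega>) =
           closest_point (X i) (player_part own i (x k \<omega>) - \<alpha> i k *\<^sub>R
             (F i (player_part own i (x k \<omega>)) (real CARD('n) *\<^sub>R v_hat k i \<omega>) + \<zeta> i k \<omega>
              + \<eta> i k *\<^sub>R player_part own i (x k \<omega>)))"
    and v_step: "\<And>k i \<omega>. \<omega> \<in> space M \<Longrightarrow> v (Suc k) i \<omega> =
           v_hat k i \<omega> + h i (player_part own i (x (Suc k) \<omega>)) - h i (player_part own i (x k \<omega>))"
    and \<zeta>_rv: "\<And>i k. \<zeta> i k \<in> borel_measurable M"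
    and \<zeta>_mean: "\<And>i k c. AE \<omega> in M.
           real_cond_exp M (history M (x 0) \<zeta> k) (\<lambda>\<omega>'. \<zeta> i k \<omega>' $ c) \<omega> = 0"
    and \<zeta>_variance: "\<And>i k. AE \<omega> in M.
           nn_cond_exp M (history M (x 0) \<zeta> k) (\<lambda>\<omega>'. ennreal ((norm (\<zeta> i k \<omega>'))\<^sup>2)) \<omega>
             \<le> ennreal ((\<upsilon> i)\<^sup>2)"
begin

abbreviation "xi i k \<omega> \<equiv> player_part own i (x k \<omega>)"
text \<open>The common reference for the step sizes of all players.\<close>

abbreviation "\<gamma> k \<equiv> (real k + 1) powr (- a)"

definition dir :: "'n \<Rightarrow> nat \<Rightarrow> 'w \<Rightarrow> real^'m" where
  "dir i k \<omega> = F i (xi i k \<omega>) (real CARD('n) *\<^sub>R v_hat k i \<omega>) + \<zeta> i k \<omega> + \<eta> i k *\<^sub>R xi i k \<omega>"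

definition dis :: "nat \<Rightarrow> 'w \<Rightarrow> real" where
  "dis k \<omega> = disagreement (\<lambda>i. v k i \<omega>)"

definition incr :: "nat \<Rightarrow> 'w \<Rightarrow> real" where
  "incr k \<omega> = (\<Sum>i\<in>UNIV. norm (h i (xi i (Suc k) \<omega>) - h i (xi i k \<omega>)))"

section \<open>Bounds valid on every sample path\<close>

lemma X_nonempty: "X i \<noteq> {}"
proof -
  obtain \<omega> where "\<omega> \<in> space M" using not_empty by blast
  then show ?thesis using x_0(2)[of \<omega> i] by blast
qed

lemma X_closed: "closed (X i)"
  using X(1) by (rule compact_imp_closed)

lemma h_continuous: "continuous_on (X i) (h i)"
  using h_lipschitz by (rule lipschitz_on_continuous_on)

lemma xi_in_X:
  assumes "\<omega> \<in> space M" shows "xi i k \<omega> \<in> X i"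
proof (cases k)
  case 0
  then show ?thesis using x_0(2)[OF assms] by simp
next
  case (Suc l)
  show ?thesis
    unfolding Suc x_step[OF assms] by (intro closest_point_in_set X_closed X_nonempty)
qed

lemma x_in_XX: "\<omega> \<in> space M \<Longrightarrow> x k \<omega> \<in> XX"
  by (simp add: XX_def xi_in_X)

lemma XX_nonempty: "XX \<noteq> {}"
proof -
  obtain \<omega> where "\<omega> \<in> space M" using not_empty by blast
  then show ?thesis using x_in_XX[of \<omega> 0] by blast
qed

lemma radius: obtains R where "0 < R" "\<And>i u. u \<in> X i \<Longrightarrow> norm u \<le> R"
proof -
  have "bounded (\<Union>i. X i)" by (intro bounded_UN ballI compact_imp_bounded X) simp
  then obtain R where "0 < R" "\<forall>u\<in>(\<Union>i. X i). norm u \<le> R" unfolding bounded_pos by blast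
  then show ?thesis using that[of R] by blast
qed

lemma h_bounded: obtains C where "0 < C" "\<And>i u. u \<in> X i \<Longrightarrow> norm (h i u) \<le> C"
proof -
  have "bounded (\<Union>i. h i ` X i)"
    by (intro bounded_UN ballI compact_imp_bounded compact_continuous_image h_continuous X) simp
  then obtain C where "0 < C" "\<forall>y\<in>(\<Union>i. h i ` X i). norm y \<le> C" unfolding bounded_pos by blast
  then show ?thesis using that[of C] by blast
qed

lemma F_bounded: obtains C where "0 < C" "\<And>i u z. u \<in> X i \<Longrightarrow> norm z \<le> c \<Longrightarrow> norm (F i u z) \<le> C"
proof -
  have "bounded (\<Union>i. (\<lambda>(u, z). F i u z) ` (X i \<times> cball 0 c))"
    by (intro bounded_UN ballI compact_imp_bounded compact_continuous_image compact_Times X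
        compact_cball continuous_on_subset[OF F_continuous]) auto
  then obtain C where C: "0 < C" "\<forall>y\<in>(\<Union>i. (\<lambda>(u, z). F i u z) ` (X i \<times> cball 0 c)). norm y \<le> C"
    unfolding bounded_pos by blast
  have "norm (F i u z) \<le> C" if "u \<in> X i" "norm z \<le> c" for i u z
  proof -
    have "F i u z \<in> (\<lambda>(u, z). F i u z) ` (X i \<times> cball 0 c)"
      using that by (intro image_eqI[of _ _ "(u, z)"]) auto
    then show ?thesis using C(2) by blast
  qed
  with C(1) show ?thesis using that by blast
qed

lemma F_lipschitz_uniform:
  assumes "0 < c"
  obtains L where "0 < L"
    "\<And>i u z1 z2. u \<in> X i \<Longrightarrow> norm z1 \<le> c \<Longrightarrow> norm z2 \<le> c \<Longrightarrow>
      norm (F i u z1 - F i u z2) \<le> L * norm (z1 - z2)"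
proof -
  have "\<forall>i. \<exists>L. \<forall>u\<in>X i. \<forall>z1 z2. norm z1 \<le> c \<and> norm z2 \<le> c \<longrightarrow>
      norm (F i u z1 - F i u z2) \<le> L * norm (z1 - z2)"
    using F_lipschitz[OF assms] by blast
  then obtain Lf where "\<forall>i. \<forall>u\<in>X i. \<forall>z1 z2. norm z1 \<le> c \<and> norm z2 \<le> c \<longrightarrow>
      norm (F i u z1 - F i u z2) \<le> Lf i * norm (z1 - z2)"
    unfolding choice_iff by blast
  then have Lf: "\<And>i u z1 z2. u \<in> X i \<Longrightarrow> norm z1 \<le> c \<Longrightarrow> norm z2 \<le> c \<Longrightarrow>
      norm (F i u z1 - F i u z2) \<le> Lf i * norm (z1 - z2)"
    by blast
  have le: "Lf i \<le> 1 + (\<Sum>i\<in>UNIV. \<bar>Lf i\<bar>)" for i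
    using member_le_sum[of i UNIV "\<lambda>i. \<bar>Lf i\<bar>"] by simp
  show ?thesis
  proof (rule that)
    show "0 < 1 + (\<Sum>i\<in>UNIV. \<bar>Lf i\<bar>)" by (simp add: add_pos_nonneg sum_nonneg)
    show "norm (F i u z1 - F i u z2) \<le> (1 + (\<Sum>i\<in>UNIV. \<bar>Lf i\<bar>)) * norm (z1 - z2)"
      if "u \<in> X i" "norm z1 \<le> c" "norm z2 \<le> c" for i u z1 z2
      using Lf[OF that] mult_right_mono[OF le[of i], of "norm (z1 - z2)"] by simp
  qed
qed

lemma v_update:
  "\<omega> \<in> space M \<Longrightarrow> v (Suc k) i \<omega> = (\<Sum>j\<in>UNIV. W k $ i $ j *\<^sub>R v k j \<omega>)
      + (h i (xi i (Suc k) \<omega>) - h i (xi i k \<omega>))"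
  by (simp add: v_step v_hat_def)

text \<open>The conservation law of gradient tracking: columns of \<open>W\<close> sum to one, so
  mixing keeps the total, and the increments of \<open>h\<close> telescope.\<close>

lemma sum_v: "\<omega> \<in> space M \<Longrightarrow> (\<Sum>i\<in>UNIV. v k i \<omega>) = \<sigma> (x k \<omega>)"
proof (induction k)
  case 0
  then show ?case by (simp add: v_0 \<sigma>_def)
next
  case (Suc k)
  then show ?case
    by (simp add: v_update sum.distrib sum_subtractf sum_doubly_stochastic[OF W_stochastic])
       (simp add: \<sigma>_def)
qed

text \<open>By conservation, \<sigma> of the state is N times the mean of \<open>v\<close>, so only
  the deviation of the mixed value from the mean remains.\<close>

lemma tracking_error: "\<omega> \<in> space M \<Longrightarrow> norm (real CARD('n) *\<^sub>R v_hat k i \<omega> - \<sigma> (x k \<omega>)) \<le> real CARD('n) * dis k \<omega>"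
proof -
  assume \<omega>: "\<omega> \<in> space M"
  have "real CARD('n) *\<^sub>R v_hat k i \<omega> - \<sigma> (x k \<omega>) = real CARD('n) *\<^sub>R (v_hat k i \<omega> - mean (\<lambda>i. v k i \<omega>))"
    by (simp add: sum_v[OF \<omega>, symmetric] sum_eq_mean scaleR_diff_right)
  then show ?thesis
    using norm_mixed_minus_mean_le[OF W_stochastic, of k i "\<lambda>i. v k i \<omega>"]
    by (simp add: dis_def v_hat_def)
qed

lemma dis_contraction:
  obtains B :: nat and \<rho> where "0 < B" "0 \<le> \<rho>" "\<rho> < 1"
    "\<And>k n \<omega>. \<omega> \<in> space M \<Longrightarrow>
      dis (k + n) \<omega> \<le> (if n = B then \<rho> else 1) * dis k \<omega> + 2 * (\<Sum>l<n. incr (k + l) \<omega>)"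
proof (rule consensus[OF self_loops W_stochastic wmin connected, where 'b = "real^'m"])
  fix B \<rho>
  assume B: "0 < B" "0 \<le> \<rho>" "\<rho> < 1"
    and step: "\<And>(v :: nat \<Rightarrow> 'n \<Rightarrow> real^'m) e s n.
      (\<And>k i. v (Suc k) i = (\<Sum>j\<in>UNIV. W k $ i $ j *\<^sub>R v k j) + e k i) \<Longrightarrow>
      disagreement (v (s + n)) \<le> (if n = B then \<rho> else 1) * disagreement (v s)
           + 2 * (\<Sum>l<n. \<Sum>i\<in>UNIV. norm (e (s + l) i))"
  show thesis
  proof (rule that[OF B])
    fix k n \<omega> assume \<omega>: "\<omega> \<in> space M"
    show "dis (k + n) \<omega> \<le> (if n = B then \<rho> else 1) * dis k \<omega> + 2 * (\<Sum>l<n. incr (k + l) \<omega>)"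
      using step[of "\<lambda>k i. v k i \<omega>" "\<lambda>k i. h i (xi i (Suc k) \<omega>) - h i (xi i k \<omega>)" k n, OF v_update[OF \<omega>]]
      by (simp add: dis_def incr_def)
  qed
qed

text \<open>Holds whatever the noise does, since projections keep the strategies in compact sets and
  hence bound the increments of \<open>h\<close>.\<close>

lemma dis_bounded: obtains D where "0 < D" "\<And>k \<omega>. \<omega> \<in> space M \<Longrightarrow> dis k \<omega> \<le> D"
proof (rule dis_contraction)
  fix B \<rho>
  assume B: "0 < B" "0 \<le> \<rho>" "\<rho> < 1"
    and step: "\<And>k n \<omega>. \<omega> \<in> space M \<Longrightarrow>
      dis (k + n) \<omega> \<le> (if n = B then \<rho> else 1) * dis k \<omega> + 2 * (\<Sum>l<n. incr (k + l) \<omega>)"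
  obtain C where C: "0 < C" "\<And>i u. u \<in> X i \<Longrightarrow> norm (h i u) \<le> C" using h_bounded by blast
  have incr: "incr k \<omega> \<le> real CARD('n) * (2 * C)" if "\<omega> \<in> space M" for k \<omega>
    unfolding incr_def mult_2
    by (intro sum_bounded_above norm_triangle_ineq4[THEN order_trans] add_mono C(2) xi_in_X that)
  have sum_incr: "(\<Sum>l<n. incr (k + l) \<omega>) \<le> real B * (real CARD('n) * (2 * C))" if "\<omega> \<in> space M" "n \<le> B" for n k \<omega>
  proof -
    have "(\<Sum>l<n. incr (k + l) \<omega>) \<le> real n * (real CARD('n) * (2 * C))"
      using sum_bounded_above[of "{..<n}" "\<lambda>l. incr (k + l) \<omega>" "real CARD('n) * (2 * C)"] incr[OF that(1)] by simp
    also have "\<dots> \<le> real B * (real CARD('n) * (2 * C))" using that C by (intro mult_right_mono) auto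
    finally show ?thesis .
  qed
  define c where "c = 2 * (real B * (real CARD('n) * (2 * C)))"
  have c: "0 \<le> c" using C by (simp add: c_def)
  \<comment> \<open>The first summand bounds the initial disagreement; fewer than \<open>B\<close>
    rounds add at most \<open>c\<close>.\<close>
  define D0 where "D0 = 2 * (real CARD('n) * C) + c"
  have start: "dis k \<omega> \<le> D0" if \<omega>: "\<omega> \<in> space M" and k: "k < B" for k \<omega>
  proof -
    have "dis 0 \<omega> \<le> 2 * (\<Sum>i\<in>UNIV. norm (v 0 i \<omega>))"
      unfolding dis_def by (rule disagreement_le_norms)
    also have "(\<Sum>i\<in>UNIV. norm (v 0 i \<omega>)) \<le> real CARD('n) * C"
      using C(2)[OF xi_in_X[OF \<omega>, of _ 0]] by (intro sum_bounded_above) (simp add: v_0[OF \<omega>])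
    finally show ?thesis
      using step[OF \<omega>, of 0 k] sum_incr[OF \<omega>, of k 0] k by (simp add: D0_def c_def)
  qed
  have "dis k \<omega> \<le> \<bar>D0\<bar> + c / (1 - \<rho>)" if \<omega>: "\<omega> \<in> space M" for k \<omega>
  proof (rule contraction_bounded[OF B c start[OF \<omega>]])
    show "dis (k + B) \<omega> \<le> \<rho> * dis k \<omega> + c" for k
      using step[OF \<omega>, of k B] sum_incr[OF \<omega>, of B k] by (simp add: c_def)
  qed
  moreover have "0 < \<bar>D0\<bar> + c / (1 - \<rho>)"
    using C c B by (auto simp: D0_def intro!: add_pos_nonneg)
  ultimately show thesis using that by blast
qed

text \<open>\<open>c\<close> is the radius at which the local Lipschitz hypothesis on
  \<open>F\<close> will be used; it has to cover both the tracked and the true aggregate.\<close>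

lemma aggregate_bounded:
  obtains c where "0 < c" "\<And>k i \<omega>. \<omega> \<in> space M \<Longrightarrow> norm (real CARD('n) *\<^sub>R v_hat k i \<omega>) \<le> c"
    "\<And>y. y \<in> XX \<Longrightarrow> norm (\<sigma> y) \<le> c"
proof -
  obtain C where C: "0 < C" "\<And>i u. u \<in> X i \<Longrightarrow> norm (h i u) \<le> C" using h_bounded by blast
  obtain D where D: "0 < D" "\<And>k \<omega>. \<omega> \<in> space M \<Longrightarrow> dis k \<omega> \<le> D" using dis_bounded by blast
  have s: "norm (\<sigma> y) \<le> real CARD('n) * C" if "y \<in> XX" for y
    unfolding \<sigma>_def using that C by (intro sum_norm_bound[THEN order_trans]) (auto simp: XX_def)
  have "norm (real CARD('n) *\<^sub>R v_hat k i \<omega>) \<le> real CARD('n) * C + real CARD('n) * D" if \<omega>: "\<omega> \<in> space M" for k i \<omega>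
  proof -
    have "real CARD('n) * dis k \<omega> \<le> real CARD('n) * D" using D(2)[OF \<omega>] by (intro mult_left_mono) auto
    then show ?thesis
      using s[OF x_in_XX[OF \<omega>, of k]] tracking_error[OF \<omega>, of k i]
        norm_triangle_sub[of "real CARD('n) *\<^sub>R v_hat k i \<omega>" "\<sigma> (x k \<omega>)"] by linarith
  qed
  moreover have "norm (\<sigma> y) \<le> real CARD('n) * C + real CARD('n) * D" if "y \<in> XX" for y
  proof -
    have "0 \<le> real CARD('n) * D" using D(1) by simp
    then show ?thesis using s[OF that] by linarith
  qed
  moreover have "0 < real CARD('n) * C + real CARD('n) * D" using C(1) D(1) by (simp add: add_pos_pos)
  ultimately show ?thesis using that by blast
qed


section \<open>Step sizes and regularisation\<close>

lemma \<alpha>_pos: "0 < \<alpha> i k"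
  using lam_pos[of i] by (simp add: \<alpha>_def add_nonneg_pos less_imp_neq[symmetric])

lemma \<eta>_nonneg: "0 \<le> \<eta> i k"
  by (simp add: \<eta>_def)

lemma \<alpha>_le: obtains c where "0 < c" "\<And>i k. \<alpha> i k \<le> c * \<gamma> k"
proof -
  have "0 \<le> a" using exponents by simp
  then show thesis
    using powr_neg_family_le[of lam a] lam_pos that unfolding \<alpha>_def by blast
qed

lemma \<eta>_le:
  obtains c where "0 < c" "\<And>i k. \<eta> i k \<le> c * (real k + 1) powr (- b)" "\<And>i k. \<eta> i k \<le> c"
proof -
  have b: "0 \<le> b" using exponents by simp
  obtain c where c: "0 < c" "\<And>i k. \<eta> i k \<le> c * (real k + 1) powr (- b)"
    using powr_neg_family_le[of \<delta> b] \<delta>_pos b unfolding \<eta>_def by blast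
  have "\<eta> i k \<le> c" for i k
  proof -
    have "(real k + 1) powr (- b) \<le> 1 powr (- b)" using b by (intro powr_mono2') auto
    then have "c * (real k + 1) powr (- b) \<le> c * 1" using c(1) by (intro mult_left_mono) auto
    then show ?thesis using c(2)[of i k] by linarith
  qed
  with c show thesis by (rule that)
qed

lemma \<gamma>_antimono: "antimono (\<lambda>k. \<gamma> k)"
  by (rule antimonoI) (use exponents in \<open>auto intro!: powr_mono2'\<close>)

lemma \<gamma>_square_summable: "summable (\<lambda>k. (\<gamma> k)\<^sup>2)"
proof -
  have "summable (\<lambda>k. real (Suc k) powr (- 2 * a))"
    using exponents by (subst summable_Suc_iff) (simp add: summable_real_powr_iff)
  moreover have "(\<gamma> k)\<^sup>2 = real (Suc k) powr (- 2 * a)" for k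
    by (simp add: power2_eq_square powr_add[symmetric] add.commute)
  ultimately show ?thesis by simp
qed

section \<open>Adaptedness to the noise history\<close>

abbreviation "H \<equiv> history M (x 0) \<zeta>"

lemma subalgebra_H: "subalgebra M (H k)"
  using x_0(1) \<zeta>_rv by (rule subalgebra_history)

lemma xi_measurable: "x k \<in> borel_measurable \<A> \<Longrightarrow> (\<lambda>\<omega>. xi i k \<omega>) \<in> borel_measurable \<A>"
  by (rule measurable_compose[OF _ borel_measurable_continuous_onI])
     (auto intro: linear_continuous_on bounded_linear_player_part)

lemma h_xi_measurable:
  assumes "x k \<in> borel_measurable \<A>" "space \<A> = space M"
  shows "(\<lambda>\<omega>. h i (xi i k \<omega>)) \<in> borel_measurable \<A>"
  by (rule borel_measurable_continuous_compose[OF xi_measurable[OF assms(1)]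
        borel_closed[OF X_closed] h_continuous])
     (use xi_in_X assms(2) in simp)

text \<open>The history is generated by noise, not by samples. Written as \<open>F\<close> plus
  noise, the update is a measurable function of the past and of \<open>\<zeta> i k\<close>, and the
  latter belongs to the history from time \<open>Suc k\<close> on.\<close>

lemma adapted: "x k \<in> borel_measurable (H k) \<and> (\<forall>i. v k i \<in> borel_measurable (H k))"
proof (induction k)
  case 0
  have x: "x 0 \<in> borel_measurable (H 0)" by (rule x0_measurable_history)
  have "v 0 i \<in> borel_measurable (H 0)" for i
    by (rule measurable_cong[THEN iffD2, OF _ h_xi_measurable[OF x space_history, of i]])
       (simp add: space_history v_0)
  with x show ?case by blast
next
  case (Suc k)
  let ?A = "H (Suc k)"
  have sub: "subalgebra ?A (H k)" by (rule subalgebra_history_mono) simp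
  have x: "x k \<in> borel_measurable ?A" and v: "\<And>i. v k i \<in> borel_measurable ?A"
    using Suc measurable_from_subalg[OF sub] by blast+
  have z: "\<zeta> i k \<in> borel_measurable ?A" for i by (rule noise_measurable_history) simp
  have vh: "(\<lambda>\<omega>. v_hat k i \<omega>) \<in> borel_measurable ?A" for i
    unfolding v_hat_def using v by measurable
  have F: "(\<lambda>\<omega>. F i (xi i k \<omega>) (real CARD('n) *\<^sub>R v_hat k i \<omega>)) \<in> borel_measurable ?A" for i
  proof -
    have "(\<lambda>\<omega>. (xi i k \<omega>, real CARD('n) *\<^sub>R v_hat k i \<omega>)) \<in> borel_measurable ?A"
      using xi_measurable[OF x, of i] vh by measurable
    then have "(\<lambda>\<omega>. (\<lambda>(u, z). F i u z) (xi i k \<omega>, real CARD('n) *\<^sub>R v_hat k i \<omega>)) \<in> borel_measurable ?A"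
      by (rule borel_measurable_continuous_compose[OF _ borel_closed F_continuous])
         (auto simp: space_history xi_in_X intro: closed_Times X_closed)
    then show ?thesis by simp
  qed
  have xs: "(\<lambda>\<omega>. xi i (Suc k) \<omega>) \<in> borel_measurable ?A" for i
  proof -
    have g: "(\<lambda>\<omega>. xi i k \<omega> - \<alpha> i k *\<^sub>R (F i (xi i k \<omega>) (real CARD('n) *\<^sub>R v_hat k i \<omega>)
        + \<zeta> i k \<omega> + \<eta> i k *\<^sub>R xi i k \<omega>)) \<in> borel_measurable ?A"
      using xi_measurable[OF x, of i] F[of i] z[of i] by measurable
    show ?thesis
      by (rule measurable_cong[THEN iffD2, OF _ measurable_compose[OF g borel_measurable_continuous_onI]])
         (auto simp: space_history x_step intro: continuous_on_closest_point[OF X(2) X_closed X_nonempty])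
  qed
  \<comment> \<open>The update is given only for the players' parts; their sum restores the stacked
    vector.\<close>
  have xS: "x (Suc k) \<in> borel_measurable ?A"
  proof -
    have "(\<lambda>\<omega>. \<Sum>i\<in>UNIV. xi i (Suc k) \<omega>) \<in> borel_measurable ?A"
      by (intro borel_measurable_sum xs)
    then show ?thesis by (simp add: sum_player_part)
  qed
  have "(\<lambda>\<omega>. v_hat k i \<omega> + h i (xi i (Suc k) \<omega>) - h i (xi i k \<omega>)) \<in> borel_measurable ?A" for i
    using vh[of i] h_xi_measurable[OF x space_history, of i] h_xi_measurable[OF xS space_history, of i]
    by measurable
  then have "v (Suc k) i \<in> borel_measurable ?A" for i
    by (rule measurable_cong[THEN iffD2, rotated]) (simp add: space_history v_step)
  with xS show ?case by blast
qed

lemma x_measurable [measurable]: "x k \<in> borel_measurable M"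
  by (rule measurable_from_subalg[OF subalgebra_H[of k] conjunct1[OF adapted]])

lemma v_measurable [measurable]: "v k i \<in> borel_measurable M"
  by (rule measurable_from_subalg[OF subalgebra_H[of k] conjunct2[OF adapted, THEN spec]])

lemma dis_measurable [measurable]: "dis k \<in> borel_measurable M"
  unfolding dis_def[abs_def] disagreement_def mean_def by measurable

lemma incr_measurable [measurable]: "incr k \<in> borel_measurable M"
proof -
  have [measurable]: "(\<lambda>\<omega>. h i (xi i k \<omega>)) \<in> borel_measurable M" for i k
    by (rule h_xi_measurable) (rule x_measurable refl)+
  show ?thesis unfolding incr_def[abs_def] by measurable
qed

lemma dis_integrable: "integrable M (dis k)"
proof (rule dis_bounded)
  fix D assume "\<And>k \<omega>. \<omega> \<in> space M \<Longrightarrow> dis k \<omega> \<le> D"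
  then show ?thesis
    by (intro integrable_const_bound[where B = D] AE_I2)
       (auto simp: dis_def disagreement_nonneg)
qed

section \<open>Moments of the noise\<close>

lemma noise_square:
  shows noise_square_integrable: "integrable M (\<lambda>\<omega>. (norm (\<zeta> i k \<omega>))\<^sup>2)"
    and noise_square_le: "(\<integral>\<omega>. (norm (\<zeta> i k \<omega>))\<^sup>2 \<partial>M) \<le> (\<upsilon> i)\<^sup>2"
  by (rule second_moment_le[OF subalgebra_H \<zeta>_rv \<zeta>_variance])+

lemma noise_norm:
  shows noise_norm_integrable: "integrable M (\<lambda>\<omega>. norm (\<zeta> i k \<omega>))"
    and noise_norm_le: "(\<integral>\<omega>. norm (\<zeta> i k \<omega>) \<partial>M) \<le> 1 + (\<upsilon> i)\<^sup>2"
  using integral_le_1_plus_square[of "\<lambda>\<omega>. norm (\<zeta> i k \<omega>)"] noise_square[of i k] \<zeta>_rv[of i k]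
  by (auto intro: order_trans)

text \<open>The current strategy is bounded and determined by the history, so the conditional mean
  zero applies.\<close>

lemma noise_orthogonal:
  shows noise_orthogonal_integrable: "integrable M (\<lambda>\<omega>. \<zeta> i k \<omega> \<bullet> xi i k \<omega>)"
    and noise_orthogonal_eq: "(\<integral>\<omega>. \<zeta> i k \<omega> \<bullet> xi i k \<omega> \<partial>M) = 0"
proof -
  obtain R where R: "0 < R" "\<And>i u. u \<in> X i \<Longrightarrow> norm u \<le> R" using radius by blast
  have m: "(\<lambda>\<omega>. xi i k \<omega>) \<in> borel_measurable (H k)"
    by (rule xi_measurable[OF conjunct1[OF adapted]])
  have sq: "integrable M (\<lambda>\<omega>. (norm (xi i k \<omega>))\<^sup>2)"
  proof (rule integrable_const_bound[where B = "R\<^sup>2"])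
    show "(\<lambda>\<omega>. (norm (xi i k \<omega>))\<^sup>2) \<in> borel_measurable M"
      using measurable_from_subalg[OF subalgebra_H m] by measurable
  qed (auto intro!: AE_I2 power_mono R(2) xi_in_X)
  show "integrable M (\<lambda>\<omega>. \<zeta> i k \<omega> \<bullet> xi i k \<omega>)" "(\<integral>\<omega>. \<zeta> i k \<omega> \<bullet> xi i k \<omega> \<partial>M) = 0"
    using integral_inner_cond_mean_zero[OF subalgebra_H m \<zeta>_rv sq noise_square_integrable \<zeta>_mean]
    by (simp_all add: inner_commute)
qed

text \<open>Bounded uniformly in \<open>K\<close> once \<Sum> \<alpha>^2 converges; this norm is the
  price of a comparison point that may depend on the noise.\<close>

lemma noise_sum:
  shows noise_sum_integrable: "integrable M (\<lambda>\<omega>. norm (\<Sum>k<K. \<alpha> i k *\<^sub>R \<zeta> i k \<omega>))"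
    and noise_sum_le: "(\<integral>\<omega>. norm (\<Sum>k<K. \<alpha> i k *\<^sub>R \<zeta> i k \<omega>) \<partial>M) \<le> 1 + (\<upsilon> i)\<^sup>2 * (\<Sum>k<K. (\<alpha> i k)\<^sup>2)"
proof -
  have sq: "integrable M (\<lambda>\<omega>. (norm (\<Sum>k<K. \<alpha> i k *\<^sub>R \<zeta> i k \<omega>))\<^sup>2)"
    "(\<integral>\<omega>. (norm (\<Sum>k<K. \<alpha> i k *\<^sub>R \<zeta> i k \<omega>))\<^sup>2 \<partial>M) \<le> (\<upsilon> i)\<^sup>2 * (\<Sum>k<K. (\<alpha> i k)\<^sup>2)"
    using martingale_second_moment[of H "\<zeta> i", OF subalgebra_H \<zeta>_rv noise_measurable_history
        noise_square_integrable noise_square_le \<zeta>_mean, where K = K and a = "\<alpha> i"] by auto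
  have m: "(\<lambda>\<omega>. norm (\<Sum>k<K. \<alpha> i k *\<^sub>R \<zeta> i k \<omega>)) \<in> borel_measurable M"
    using \<zeta>_rv by measurable
  show "integrable M (\<lambda>\<omega>. norm (\<Sum>k<K. \<alpha> i k *\<^sub>R \<zeta> i k \<omega>))"
    "(\<integral>\<omega>. norm (\<Sum>k<K. \<alpha> i k *\<^sub>R \<zeta> i k \<omega>) \<partial>M) \<le> 1 + (\<upsilon> i)\<^sup>2 * (\<Sum>k<K. (\<alpha> i k)\<^sup>2)"
    using integral_le_1_plus_square[OF m sq(1)] sq(2) by linarith+
qed

section \<open>Drift, increments and expected disagreement\<close>

lemma F_dynamics_bounded:
  obtains C L where "0 < C" "0 < L"
    "\<And>i k \<omega>. \<omega> \<in> space M \<Longrightarrow> norm (F i (xi i k \<omega>) (real CARD('n) *\<^sub>R v_hat k i \<omega>)) \<le> C"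
    "\<And>i y. y \<in> XX \<Longrightarrow> norm (F i (player_part own i y) (\<sigma> y)) \<le> C"
    "\<And>i k \<omega>. \<omega> \<in> space M \<Longrightarrow> norm (F i (xi i k \<omega>) (real CARD('n) *\<^sub>R v_hat k i \<omega>)
       - F i (xi i k \<omega>) (\<sigma> (x k \<omega>))) \<le> L * dis k \<omega>"
proof (rule aggregate_bounded)
  fix c assume c: "0 < c" "\<And>k i \<omega>. \<omega> \<in> space M \<Longrightarrow> norm (real CARD('n) *\<^sub>R v_hat k i \<omega>) \<le> c"
    "\<And>y. y \<in> XX \<Longrightarrow> norm (\<sigma> y) \<le> c"
  show thesis
  proof (rule F_bounded[of c], rule F_lipschitz_uniform[OF c(1)])
    fix C L assume C: "0 < C" "\<And>i u z. u \<in> X i \<Longrightarrow> norm z \<le> c \<Longrightarrow> norm (F i u z) \<le> C"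
      and L: "0 < L" "\<And>i u z1 z2. u \<in> X i \<Longrightarrow> norm z1 \<le> c \<Longrightarrow> norm z2 \<le> c \<Longrightarrow>
        norm (F i u z1 - F i u z2) \<le> L * norm (z1 - z2)"
    show thesis
    proof (rule that[of C "L * real CARD('n)"])
      fix i k \<omega> assume \<omega>: "\<omega> \<in> space M"
      have "norm (F i (xi i k \<omega>) (real CARD('n) *\<^sub>R v_hat k i \<omega>) - F i (xi i k \<omega>) (\<sigma> (x k \<omega>)))
          \<le> L * norm (real CARD('n) *\<^sub>R v_hat k i \<omega> - \<sigma> (x k \<omega>))"
        by (intro L(2) xi_in_X c x_in_XX \<omega>)
      also have "\<dots> \<le> L * (real CARD('n) * dis k \<omega>)"
        by (intro mult_left_mono tracking_error \<omega>) (use L in simp)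
      finally show "norm (F i (xi i k \<omega>) (real CARD('n) *\<^sub>R v_hat k i \<omega>)
         - F i (xi i k \<omega>) (\<sigma> (x k \<omega>))) \<le> L * real CARD('n) * dis k \<omega>" by (simp only: mult.assoc)
      show "norm (F i (xi i k \<omega>) (real CARD('n) *\<^sub>R v_hat k i \<omega>)) \<le> C"
        by (intro C(2) xi_in_X c \<omega>)
    next
      fix i y assume y: "y \<in> XX"
      then have "player_part own i y \<in> X i" by (simp add: XX_def)
      then show "norm (F i (player_part own i y) (\<sigma> y)) \<le> C" by (intro C(2) c y)
    qed (use C L in auto)
  qed
qed

text \<open>The projection is nonexpansive and fixes y. Used with the current strategy as y for the
  step length, and with a comparison point for descent.\<close>

lemma xi_move:
  assumes \<omega>: "\<omega> \<in> space M" and y: "y \<in> X i"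
  shows "norm (xi i (Suc k) \<omega> - y) \<le> norm (xi i k \<omega> - y - \<alpha> i k *\<^sub>R dir i k \<omega>)"
proof -
  have "dist (closest_point (X i) (xi i k \<omega> - \<alpha> i k *\<^sub>R dir i k \<omega>)) (closest_point (X i) y)
      \<le> dist (xi i k \<omega> - \<alpha> i k *\<^sub>R dir i k \<omega>) y"
    by (intro closest_point_lipschitz X X_closed X_nonempty)
  then show ?thesis
    using closest_point_self[OF y] by (simp add: x_step[OF \<omega>] dir_def dist_norm algebra_simps)
qed

text \<open>The step length is at most \<alpha> times the norm of the direction, which contains
  unbounded noise; the expectation of that norm is bounded, which gives order \<gamma>.\<close>

lemma incr_expectation:
  obtains c where "0 \<le> c" "\<And>k. integrable M (incr k)" "\<And>k. (\<integral>\<omega>. incr k \<omega> \<partial>M) \<le> c * \<gamma> k"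
proof (rule F_dynamics_bounded)
  fix C L assume C: "0 < C"
    "\<And>i k \<omega>. \<omega> \<in> space M \<Longrightarrow> norm (F i (xi i k \<omega>) (real CARD('n) *\<^sub>R v_hat k i \<omega>)) \<le> C"
  obtain R where R: "0 < R" "\<And>i u. u \<in> X i \<Longrightarrow> norm u \<le> R" using radius by blast
  obtain ca where ca: "0 < ca" "\<And>i k. \<alpha> i k \<le> ca * \<gamma> k" using \<alpha>_le by blast
  obtain cd where cd: "0 < cd" "\<And>i k. \<eta> i k \<le> cd * (real k + 1) powr (- b)"
    and \<eta>: "\<And>i k. \<eta> i k \<le> cd"
    using \<eta>_le by blast
  have Lh: "0 \<le> Lh i" for i using h_lipschitz by (rule lipschitz_on_nonneg)
  have dir: "norm (dir i k \<omega>) \<le> C + norm (\<zeta> i k \<omega>) + cd * R" if \<omega>: "\<omega> \<in> space M" for i k \<omega>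
  proof -
    have "norm (\<eta> i k *\<^sub>R xi i k \<omega>) \<le> cd * R"
      using mult_mono[OF \<eta>[of i k] R(2)[OF xi_in_X[OF \<omega>, of i k]]] cd \<eta>_nonneg by simp
    then show ?thesis
      unfolding dir_def
      using C(2)[OF \<omega>, of i k] norm_triangle_ineq[of "F i (xi i k \<omega>) (real CARD('n) *\<^sub>R v_hat k i \<omega>)" "\<zeta> i k \<omega>"]
        norm_triangle_ineq[of "F i (xi i k \<omega>) (real CARD('n) *\<^sub>R v_hat k i \<omega>) + \<zeta> i k \<omega>" "\<eta> i k *\<^sub>R xi i k \<omega>"]
      by linarith
  qed
  let ?b = "\<lambda>k \<omega>. \<Sum>i\<in>UNIV. Lh i * (ca * \<gamma> k * (C + norm (\<zeta> i k \<omega>) + cd * R))"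
  have le: "incr k \<omega> \<le> ?b k \<omega>" if \<omega>: "\<omega> \<in> space M" for k \<omega>
    unfolding incr_def
  proof (rule sum_mono)
    fix i
    have "norm (h i (xi i (Suc k) \<omega>) - h i (xi i k \<omega>)) \<le> Lh i * norm (xi i (Suc k) \<omega> - xi i k \<omega>)"
      using lipschitz_onD[OF h_lipschitz xi_in_X xi_in_X, OF \<omega> \<omega>] by (simp add: dist_norm)
    also have "norm (xi i (Suc k) \<omega> - xi i k \<omega>) \<le> \<alpha> i k * norm (dir i k \<omega>)"
      using xi_move[OF \<omega> xi_in_X[OF \<omega>, where i = i and k = k], where k = k] \<alpha>_pos[of i k] by simp
    also have "\<dots> \<le> ca * \<gamma> k * (C + norm (\<zeta> i k \<omega>) + cd * R)"
      using ca dir[OF \<omega>] by (intro mult_mono) auto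
    finally show "norm (h i (xi i (Suc k) \<omega>) - h i (xi i k \<omega>))
        \<le> Lh i * (ca * \<gamma> k * (C + norm (\<zeta> i k \<omega>) + cd * R))"
      using Lh[of i] by (simp add: mult_left_mono)
  qed
  have intb: "integrable M (?b k)" for k
    by (intro Bochner_Integration.integrable_sum integrable_mult_right Bochner_Integration.integrable_add
        noise_norm_integrable integrable_const)
  have int: "integrable M (incr k)" for k
  proof (rule Bochner_Integration.integrable_bound[OF intb])
    have "0 \<le> incr k \<omega>" for \<omega> by (simp add: incr_def sum_nonneg)
    then have "norm (incr k \<omega>) \<le> norm (?b k \<omega>)" if "\<omega> \<in> space M" for \<omega>
      using le[OF that, of k] by simp
    then show "AE \<omega> in M. norm (incr k \<omega>) \<le> norm (?b k \<omega>)" by (rule AE_I2)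
  qed measurable
  show thesis
  proof (rule that[of "\<Sum>i\<in>UNIV. Lh i * (ca * (C + (1 + (\<upsilon> i)\<^sup>2) + cd * R))"])
    show "0 \<le> (\<Sum>i\<in>UNIV. Lh i * (ca * (C + (1 + (\<upsilon> i)\<^sup>2) + cd * R)))"
      using Lh ca cd C R by (intro sum_nonneg mult_nonneg_nonneg add_nonneg_nonneg) auto
    fix k
    have "(\<integral>\<omega>. incr k \<omega> \<partial>M) \<le> (\<integral>\<omega>. ?b k \<omega> \<partial>M)"
      by (intro integral_mono int intb le)
    also have "\<dots> = (\<Sum>i\<in>UNIV. Lh i * (ca * \<gamma> k * (C + (\<integral>\<omega>. norm (\<zeta> i k \<omega>) \<partial>M) + cd * R)))"
      using noise_norm_integrable by (simp add: prob_space)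
    also have "\<dots> \<le> (\<Sum>i\<in>UNIV. Lh i * (ca * \<gamma> k * (C + (1 + (\<upsilon> i)\<^sup>2) + cd * R)))"
      using Lh ca cd noise_norm_le by (intro sum_mono mult_left_mono add_mono) auto
    also have "\<dots> = (\<Sum>i\<in>UNIV. Lh i * (ca * (C + (1 + (\<upsilon> i)\<^sup>2) + cd * R))) * \<gamma> k"
      unfolding sum_distrib_right by (intro sum.cong refl) (simp add: ac_simps)
    finally show "(\<integral>\<omega>. incr k \<omega> \<partial>M)
      \<le> (\<Sum>i\<in>UNIV. Lh i * (ca * (C + (1 + (\<upsilon> i)\<^sup>2) + cd * R))) * \<gamma> k" .
  qed (rule int)
qed

text \<open>The pathwise contraction is linear in disagreement and increments, so it passes to
  expectations, where the increments are of order \<gamma>.\<close>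

lemma dis_weighted_sum_bounded:
  obtains C where "\<And>K. (\<Sum>k<K. \<gamma> k * (\<integral>\<omega>. dis k \<omega> \<partial>M)) \<le> C"
proof (rule dis_contraction, rule incr_expectation)
  fix B \<rho> c
  assume B: "0 < B" "0 \<le> \<rho>" "\<rho> < 1"
    and step: "\<And>k n \<omega>. \<omega> \<in> space M \<Longrightarrow>
      dis (k + n) \<omega> \<le> (if n = B then \<rho> else 1) * dis k \<omega> + 2 * (\<Sum>l<n. incr (k + l) \<omega>)"
    and c: "0 \<le> c" "\<And>k. integrable M (incr k)" "\<And>k. (\<integral>\<omega>. incr k \<omega> \<partial>M) \<le> c * \<gamma> k"
  show thesis
  proof (rule weighted_contraction_sum_bounded[OF B])
    show "0 \<le> 2 * c" using c by simp
    show "antimono \<gamma>" by (rule \<gamma>_antimono)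
    show "summable (\<lambda>k. (\<gamma> k)\<^sup>2)" by (rule \<gamma>_square_summable)
    show "0 \<le> (\<integral>\<omega>. dis k \<omega> \<partial>M)" for k
      by (intro Bochner_Integration.integral_nonneg) (simp add: dis_def disagreement_nonneg)
    show "(\<integral>\<omega>. dis (k + B) \<omega> \<partial>M) \<le> \<rho> * (\<integral>\<omega>. dis k \<omega> \<partial>M) + 2 * c * (\<Sum>l<B. \<gamma> (k + l))" for k
    proof -
      have "(\<integral>\<omega>. dis (k + B) \<omega> \<partial>M) \<le> (\<integral>\<omega>. \<rho> * dis k \<omega> + 2 * (\<Sum>l<B. incr (k + l) \<omega>) \<partial>M)"
      proof (rule integral_mono)
        show "integrable M (\<lambda>\<omega>. \<rho> * dis k \<omega> + 2 * (\<Sum>l<B. incr (k + l) \<omega>))"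
          by (intro Bochner_Integration.integrable_add integrable_mult_right
              Bochner_Integration.integrable_sum dis_integrable c(2))
      qed (use step[of _ k B] dis_integrable in auto)
      also have "\<dots> = \<rho> * (\<integral>\<omega>. dis k \<omega> \<partial>M) + 2 * (\<Sum>l<B. \<integral>\<omega>. incr (k + l) \<omega> \<partial>M)"
        using dis_integrable c(2) by simp
      also have "(\<Sum>l<B. \<integral>\<omega>. incr (k + l) \<omega> \<partial>M) \<le> (\<Sum>l<B. c * \<gamma> (k + l))"
        by (intro sum_mono c)
      finally show ?thesis by (simp add: sum_distrib_left[symmetric])
    qed
  qed (use that in auto)
qed

text \<open>Expand the squared distance after the projected step. The tracked aggregate is replaced
  by the true one at the cost of \<open>dis\<close>, the regularisation by its size, and the noise
  paired with x - y by two separate terms, so that the one with y can be summed over time before it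
  is bounded.\<close>

lemma one_step:
  assumes \<omega>: "\<omega> \<in> space M" and y: "y \<in> X i"
    and R: "\<And>u. u \<in> X i \<Longrightarrow> norm u \<le> R"
    and C: "norm (F i (xi i k \<omega>) (real CARD('n) *\<^sub>R v_hat k i \<omega>)) \<le> C"
    and L: "norm (F i (xi i k \<omega>) (real CARD('n) *\<^sub>R v_hat k i \<omega>) - F i (xi i k \<omega>) (\<sigma> (x k \<omega>))) \<le> L * dis k \<omega>"
  shows "\<alpha> i k * (F i (xi i k \<omega>) (\<sigma> (x k \<omega>)) \<bullet> (xi i k \<omega> - y))
    \<le> ((norm (xi i k \<omega> - y))\<^sup>2 - (norm (xi i (Suc k) \<omega> - y))\<^sup>2) / 2
      + \<alpha> i k * (2 * R * L * dis k \<omega> + 2 * R\<^sup>2 * \<eta> i k - \<zeta> i k \<omega> \<bullet> xi i k \<omega>)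
      + (\<alpha> i k *\<^sub>R \<zeta> i k \<omega>) \<bullet> y
      + 3 / 2 * (\<alpha> i k)\<^sup>2 * (C\<^sup>2 + (norm (\<zeta> i k \<omega>))\<^sup>2 + (\<eta> i k * R)\<^sup>2)"
proof -
  define A where "A = \<alpha> i k"
  define u where "u = xi i k \<omega>"
  define d where "d = u - y"
  define f where "f = F i u (\<sigma> (x k \<omega>))"
  define f' where "f' = F i u (real CARD('n) *\<^sub>R v_hat k i \<omega>)"
  define z where "z = \<zeta> i k \<omega>"
  define e where "e = \<eta> i k"
  define g where "g = dir i k \<omega>"
  note defs = A_def u_def d_def f_def f'_def z_def e_def g_def
  have g: "g = f' + z + e *\<^sub>R u" by (simp add: g_def dir_def f'_def u_def z_def e_def)
  have u: "norm u \<le> R" "norm y \<le> R" using R[OF xi_in_X[OF \<omega>]] R[OF y] by (simp_all add: u_def)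
  have d: "norm d \<le> 2 * R" using u norm_triangle_ineq4[of u y] by (simp add: d_def)
  have A: "0 \<le> A" using \<alpha>_pos[of i k] by (simp add: A_def)
  have e: "0 \<le> e" by (simp add: e_def \<eta>_nonneg)
  have "(norm (xi i (Suc k) \<omega> - y))\<^sup>2 \<le> (norm (d - A *\<^sub>R g))\<^sup>2"
    using xi_move[OF \<omega> y, of k] by (intro power_mono) (simp_all add: d_def u_def A_def g_def)
  also have "\<dots> = (norm d)\<^sup>2 - 2 * (A * (g \<bullet> d)) + A\<^sup>2 * (norm g)\<^sup>2"
    unfolding power2_norm_eq_inner
    by (simp add: inner_diff_left inner_diff_right inner_commute power2_eq_square algebra_simps)
  finally have move: "(norm (xi i (Suc k) \<omega> - y))\<^sup>2 \<le> (norm d)\<^sup>2 - 2 * (A * (g \<bullet> d)) + A\<^sup>2 * (norm g)\<^sup>2" .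
  have "norm (e *\<^sub>R u) \<le> e * R" using e u by (simp add: mult_left_mono)
  \<comment> \<open>The factor 3 from squaring a sum of three terms, halved at the end, is the
    origin of 3/2.\<close>
  then have "(norm g)\<^sup>2 \<le> 3 * (C\<^sup>2 + (norm z)\<^sup>2 + (e * R)\<^sup>2)"
    unfolding g by (intro norm_add3_squared_le) (use C in \<open>simp_all add: f'_def u_def\<close>)
  then have "A\<^sup>2 * (norm g)\<^sup>2 \<le> A\<^sup>2 * (3 * (C\<^sup>2 + (norm z)\<^sup>2 + (e * R)\<^sup>2))"
    by (rule mult_left_mono) simp
  also have "\<dots> = 2 * (3 / 2 * A\<^sup>2 * (C\<^sup>2 + (norm z)\<^sup>2 + (e * R)\<^sup>2))"
    by simp
  finally have quad: "A\<^sup>2 * (norm g)\<^sup>2 \<le> 2 * (3 / 2 * A\<^sup>2 * (C\<^sup>2 + (norm z)\<^sup>2 + (e * R)\<^sup>2))" .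
  have "(f - f') \<bullet> d \<le> norm (f' - f) * norm d"
    using norm_cauchy_schwarz[of "f - f'" d] by (simp add: norm_minus_commute)
  also have "\<dots> \<le> (L * dis k \<omega>) * (2 * R)"
    using L d by (intro mult_mono) (auto simp: f_def f'_def u_def intro: order_trans[OF norm_ge_zero])
  finally have 3: "f \<bullet> d - f' \<bullet> d \<le> 2 * R * L * dis k \<omega>" by (simp add: inner_diff_left ac_simps)
  have "- (u \<bullet> d) \<le> norm u * norm d" using norm_cauchy_schwarz[of "- u" d] by simp
  also have "\<dots> \<le> R * (2 * R)" using u d by (intro mult_mono) (auto intro: order_trans[OF norm_ge_zero])
  finally have 4: "- (e * (u \<bullet> d)) \<le> 2 * R\<^sup>2 * e"
    using mult_left_mono[OF _ e, of "- (u \<bullet> d)" "R * (2 * R)"] by (simp add: power2_eq_square ac_simps)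
  have "f \<bullet> d \<le> g \<bullet> d + (2 * R * L * dis k \<omega> + 2 * R\<^sup>2 * e - z \<bullet> u) + z \<bullet> y"
  proof -
    have gd: "g \<bullet> d = f' \<bullet> d + z \<bullet> d + e * (u \<bullet> d)" by (simp add: g inner_add_left)
    have zd: "z \<bullet> d = z \<bullet> u - z \<bullet> y" by (simp add: d_def inner_diff_right)
    show ?thesis using 3 4 unfolding gd zd by linarith
  qed
  then have "A * (f \<bullet> d) \<le> A * (g \<bullet> d + (2 * R * L * dis k \<omega> + 2 * R\<^sup>2 * e - z \<bullet> u) + z \<bullet> y)"
    using A by (rule mult_left_mono)
  also have "\<dots> = A * (g \<bullet> d) + A * (2 * R * L * dis k \<omega> + 2 * R\<^sup>2 * e - z \<bullet> u) + (A *\<^sub>R z) \<bullet> y"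
    by (simp add: algebra_simps)
  finally have main: "A * (f \<bullet> d) \<le> A * (g \<bullet> d) + A * (2 * R * L * dis k \<omega> + 2 * R\<^sup>2 * e - z \<bullet> u) + (A *\<^sub>R z) \<bullet> y" .
  \<comment> \<open>Pure arithmetic on variables: halve the distance inequality and insert the other
    two.\<close>
  have combine: "t \<le> (p - r) / 2 + s + w + h"
    if "r \<le> p - 2 * m + n" "n \<le> 2 * h" "t \<le> m + s + w" for t p r s w h m n :: real
    using that by argo
  show ?thesis using combine[OF move quad main] by (simp only: defs)
qed

section \<open>From single steps to the gap\<close>

abbreviation "\<alpha>_max k \<equiv> Max (range (\<lambda>i. \<alpha> i k))"

text \<open>Independent of the comparison point \<open>y\<close>, which meets the noise only in the inner product
  with the martingale sum; this is what lets the supremum over \<open>y\<close> precede the expectation.\<close>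

definition player_bound :: "real \<Rightarrow> real \<Rightarrow> real \<Rightarrow> 'n \<Rightarrow> nat \<Rightarrow> 'w \<Rightarrow> real" where
  "player_bound R C L i K \<omega> = 2 * R\<^sup>2
    + (\<Sum>k<K. (\<alpha>_max k - \<alpha> i k) * (2 * R * C)
       + \<alpha> i k * (2 * R * L * dis k \<omega> + 2 * R\<^sup>2 * \<eta> i k - \<zeta> i k \<omega> \<bullet> xi i k \<omega>)
       + 3 / 2 * (\<alpha> i k)\<^sup>2 * (C\<^sup>2 + (norm (\<zeta> i k \<omega>))\<^sup>2 + (\<eta> i k * R)\<^sup>2))
    + R * norm (\<Sum>k<K. \<alpha> i k *\<^sub>R \<zeta> i k \<omega>)"

text \<open>Since \<open>\<alpha>_max k - \<alpha> i k\<close> is nonnegative, passing to the common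
  weight costs at most this difference times the drift bound 2 R C. Then the squared distances
  telescope, and the noise is summed before Cauchy-Schwarz with y.\<close>

lemma player_gap_le:
  assumes \<omega>: "\<omega> \<in> space M" and y: "y \<in> X i"
    and R: "\<And>u. u \<in> X i \<Longrightarrow> norm u \<le> R"
    and C: "\<And>k. norm (F i (xi i k \<omega>) (real CARD('n) *\<^sub>R v_hat k i \<omega>)) \<le> C"
      "\<And>k. norm (F i (xi i k \<omega>) (\<sigma> (x k \<omega>))) \<le> C"
    and L: "\<And>k. norm (F i (xi i k \<omega>) (real CARD('n) *\<^sub>R v_hat k i \<omega>) - F i (xi i k \<omega>) (\<sigma> (x k \<omega>))) \<le> L * dis k \<omega>"
  shows "(\<Sum>k<K. \<alpha>_max k * (F i (xi i k \<omega>) (\<sigma> (x k \<omega>)) \<bullet> (xi i k \<omega> - y))) \<le> player_bound R C L i K \<omega>"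
proof -
  let ?f = "\<lambda>k. F i (xi i k \<omega>) (\<sigma> (x k \<omega>))"
  let ?n = "\<lambda>k. (norm (xi i k \<omega> - y))\<^sup>2 / 2"
  let ?t = "\<lambda>k. (\<alpha>_max k - \<alpha> i k) * (2 * R * C)
       + \<alpha> i k * (2 * R * L * dis k \<omega> + 2 * R\<^sup>2 * \<eta> i k - \<zeta> i k \<omega> \<bullet> xi i k \<omega>)
       + 3 / 2 * (\<alpha> i k)\<^sup>2 * (C\<^sup>2 + (norm (\<zeta> i k \<omega>))\<^sup>2 + (\<eta> i k * R)\<^sup>2)"
  have d: "norm (xi i k \<omega> - y) \<le> 2 * R" for k
    using R[OF xi_in_X[OF \<omega>, of i k]] R[OF y] norm_triangle_ineq4[of "xi i k \<omega>" y] by simp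
  have "(\<Sum>k<K. \<alpha>_max k * (?f k \<bullet> (xi i k \<omega> - y)))
      \<le> (\<Sum>k<K. (?n k - ?n (Suc k)) + ?t k + (\<alpha> i k *\<^sub>R \<zeta> i k \<omega>) \<bullet> y)"
  proof (rule sum_mono)
    fix k
    have "?f k \<bullet> (xi i k \<omega> - y) \<le> norm (?f k) * norm (xi i k \<omega> - y)" by (rule norm_cauchy_schwarz)
    also have "\<dots> \<le> C * (2 * R)"
      using C(2) d by (intro mult_mono) (auto intro: order_trans[OF norm_ge_zero])
    finally have drift: "(\<alpha>_max k - \<alpha> i k) * (?f k \<bullet> (xi i k \<omega> - y)) \<le> (\<alpha>_max k - \<alpha> i k) * (2 * R * C)"
      by (intro mult_left_mono) (simp_all add: ac_simps)
    have step: "\<alpha> i k * (?f k \<bullet> (xi i k \<omega> - y)) \<le> (?n k - ?n (Suc k))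
        + \<alpha> i k * (2 * R * L * dis k \<omega> + 2 * R\<^sup>2 * \<eta> i k - \<zeta> i k \<omega> \<bullet> xi i k \<omega>)
        + (\<alpha> i k *\<^sub>R \<zeta> i k \<omega>) \<bullet> y
        + 3 / 2 * (\<alpha> i k)\<^sup>2 * (C\<^sup>2 + (norm (\<zeta> i k \<omega>))\<^sup>2 + (\<eta> i k * R)\<^sup>2)"
      using one_step[OF \<omega> y R C(1) L, of k] by (simp only: diff_divide_distrib)
    have combine: "am * f \<le> n + (t1 + t2 + t3) + z" if "(am - a) * f \<le> t1" "a * f \<le> n + t2 + z + t3"
      for am f a n t1 t2 t3 z :: real using that by (simp add: left_diff_distrib)
    show "\<alpha>_max k * (?f k \<bullet> (xi i k \<omega> - y)) \<le> (?n k - ?n (Suc k)) + ?t k + (\<alpha> i k *\<^sub>R \<zeta> i k \<omega>) \<bullet> y"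
      by (rule combine[OF drift step])
  qed
  also have "\<dots> = (?n 0 - ?n K) + (\<Sum>k<K. ?t k) + (\<Sum>k<K. \<alpha> i k *\<^sub>R \<zeta> i k \<omega>) \<bullet> y"
  proof -
    have "(\<Sum>k<K. ?n k - ?n (Suc k)) = ?n 0 - ?n K" by (rule sum_lessThan_telescope')
    then show ?thesis by (simp only: sum.distrib inner_sum_left)
  qed
  also have "(\<Sum>k<K. \<alpha> i k *\<^sub>R \<zeta> i k \<omega>) \<bullet> y \<le> R * norm (\<Sum>k<K. \<alpha> i k *\<^sub>R \<zeta> i k \<omega>)"
    by (rule order_trans[OF norm_cauchy_schwarz], subst mult.commute)
       (rule mult_right_mono[OF R[OF y] norm_ge_zero])
  \<comment> \<open>Half the square of the diameter bound 2 R.\<close>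
  also have "?n 0 - ?n K \<le> 2 * R\<^sup>2"
  proof -
    have "(norm (xi i 0 \<omega> - y))\<^sup>2 \<le> 4 * R\<^sup>2"
      using power_mono[OF d[of 0], of 2] by (simp add: power_mult_distrib)
    moreover have "0 \<le> (norm (xi i K \<omega> - y))\<^sup>2" by simp
    ultimately show ?thesis by linarith
  qed
  finally show ?thesis by (simp add: player_bound_def)
qed

text \<open>Every sum is bounded in \<open>K\<close> except the regularisation \<Sum> \<alpha>
  \<eta>, which is compared with the sum of (k+1)^(-(a+b)) and may grow like K^(1-(a+b)).\<close>

lemma player_bound_expectation:
  assumes R: "0 < R" and C: "0 < C" and L: "0 < L"
  obtains c where "0 \<le> c" "\<And>K. integrable M (player_bound R C L i K)"
    "\<And>K. 1 \<le> K \<Longrightarrow> (\<integral>\<omega>. player_bound R C L i K \<omega> \<partial>M) \<le> c * (1 + real K powr (1 - (a + b)))"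
proof -
  obtain ca where ca: "0 < ca" "\<And>i k. \<alpha> i k \<le> ca * \<gamma> k" using \<alpha>_le by blast
  obtain cd where cd: "0 < cd" "\<And>i k. \<eta> i k \<le> cd * (real k + 1) powr (- b)"
    and \<eta>: "\<And>i k. \<eta> i k \<le> cd"
    using \<eta>_le by blast
  obtain cl where cl: "\<And>K. (\<Sum>k<K. \<alpha>_max k - \<alpha> i k) \<le> cl"
    using Max_powr_neg_diff_sum_bounded[of lam a i] lam_pos exponents unfolding \<alpha>_def by auto
  obtain cD where cD: "\<And>K. (\<Sum>k<K. \<gamma> k * (\<integral>\<omega>. dis k \<omega> \<partial>M)) \<le> cD"
    by (rule dis_weighted_sum_bounded) blast
  define S where "S = (\<Sum>k. (\<gamma> k)\<^sup>2)"
  define q where "q = 3 / 2 * ca\<^sup>2 * (C\<^sup>2 + (\<upsilon> i)\<^sup>2 + (cd * R)\<^sup>2)"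
  have q: "0 \<le> q" by (simp add: q_def)
  have \<alpha>2: "(\<alpha> i k)\<^sup>2 \<le> ca\<^sup>2 * (\<gamma> k)\<^sup>2" for k
    using power_mono[OF ca(2)[of i k] less_imp_le[OF \<alpha>_pos], of 2] by (simp add: power_mult_distrib)
  have S: "(\<Sum>k<K. (\<gamma> k)\<^sup>2) \<le> S" for K
    unfolding S_def by (intro sum_le_suminf \<gamma>_square_summable) auto
  let ?t = "\<lambda>k \<omega>. (\<alpha>_max k - \<alpha> i k) * (2 * R * C)
       + \<alpha> i k * (2 * R * L * dis k \<omega> + 2 * R\<^sup>2 * \<eta> i k - \<zeta> i k \<omega> \<bullet> xi i k \<omega>)
       + 3 / 2 * (\<alpha> i k)\<^sup>2 * (C\<^sup>2 + (norm (\<zeta> i k \<omega>))\<^sup>2 + (\<eta> i k * R)\<^sup>2)"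
  \<comment> \<open>Expectation of \<open>?t\<close>: the pairing of noise and strategy has dropped
    out.\<close>
  let ?e = "\<lambda>k. (\<alpha>_max k - \<alpha> i k) * (2 * R * C)
       + \<alpha> i k * (2 * R * L * (\<integral>\<omega>. dis k \<omega> \<partial>M) + 2 * R\<^sup>2 * \<eta> i k)
       + 3 / 2 * (\<alpha> i k)\<^sup>2 * (C\<^sup>2 + (\<integral>\<omega>. (norm (\<zeta> i k \<omega>))\<^sup>2 \<partial>M) + (\<eta> i k * R)\<^sup>2)"
  note ints = dis_integrable noise_orthogonal_integrable noise_square_integrable noise_sum_integrable
  have t: "integrable M (?t k)" "(\<integral>\<omega>. ?t k \<omega> \<partial>M) = ?e k" for k
    using ints by (simp_all add: prob_space noise_orthogonal_eq)
  let ?u = "\<lambda>k. (\<alpha>_max k - \<alpha> i k) * (2 * R * C) + 2 * R * L * ca * (\<gamma> k * (\<integral>\<omega>. dis k \<omega> \<partial>M))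
       + 2 * R\<^sup>2 * ca * cd * (real k + 1) powr (- (a + b)) + q * (\<gamma> k)\<^sup>2"
  have e_le: "?e k \<le> ?u k" for k
  proof -
    have D: "0 \<le> (\<integral>\<omega>. dis k \<omega> \<partial>M)"
      by (intro Bochner_Integration.integral_nonneg) (simp add: dis_def disagreement_nonneg)
    have "\<alpha> i k * (2 * R * L * (\<integral>\<omega>. dis k \<omega> \<partial>M)) \<le> ca * \<gamma> k * (2 * R * L * (\<integral>\<omega>. dis k \<omega> \<partial>M))"
      using D R L ca by (intro mult_right_mono) auto
    moreover have "\<alpha> i k * \<eta> i k \<le> (ca * \<gamma> k) * (cd * (real k + 1) powr (- b))"
      using ca cd by (intro mult_mono) (auto simp: \<eta>_nonneg)
    then have "2 * R\<^sup>2 * (\<alpha> i k * \<eta> i k) \<le> 2 * R\<^sup>2 * ((ca * \<gamma> k) * (cd * (real k + 1) powr (- b)))"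
      by (intro mult_left_mono) auto
    moreover have "\<gamma> k * (real k + 1) powr (- b) = (real k + 1) powr (- (a + b))"
      by (simp add: powr_add[symmetric])
    moreover have "(\<alpha> i k)\<^sup>2 * (C\<^sup>2 + (\<integral>\<omega>. (norm (\<zeta> i k \<omega>))\<^sup>2 \<partial>M) + (\<eta> i k * R)\<^sup>2)
        \<le> (ca\<^sup>2 * (\<gamma> k)\<^sup>2) * (C\<^sup>2 + (\<upsilon> i)\<^sup>2 + (cd * R)\<^sup>2)"
      using \<alpha>2 noise_square_le \<eta> R C cd by (intro mult_mono add_mono power_mono) (auto simp: \<eta>_nonneg)
    ultimately show ?thesis by (simp add: q_def algebra_simps)
  qed
  \<comment> \<open>\<open>c0\<close> collects the initial distance, the step mismatch, the tracking
    error, the squared steps and the martingale norm; \<open>c1\<close> is the regularisation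
    alone.\<close>
  define c0 where "c0 = 2 * R\<^sup>2 + cl * (2 * R * C) + 2 * R * L * ca * cD + q * S
      + R * (1 + (\<upsilon> i)\<^sup>2 * (ca\<^sup>2 * S))"
  define c1 where "c1 = 2 * R\<^sup>2 * ca * cd / (1 - (a + b))"
  have int: "integrable M (player_bound R C L i K)" for K
    unfolding player_bound_def
    by (intro Bochner_Integration.integrable_add Bochner_Integration.integrable_sum integrable_const
        integrable_mult_right t(1) noise_sum_integrable)
  have "(\<integral>\<omega>. player_bound R C L i K \<omega> \<partial>M) \<le> c0 + c1 * real K powr (1 - (a + b))" for K
  proof -
    have "(\<integral>\<omega>. player_bound R C L i K \<omega> \<partial>M) = 2 * R\<^sup>2 + (\<Sum>k<K. ?e k)
        + R * (\<integral>\<omega>. norm (\<Sum>k<K. \<alpha> i k *\<^sub>R \<zeta> i k \<omega>) \<partial>M)"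
    proof -
      have "integrable M (\<lambda>\<omega>. \<Sum>k<K. ?t k \<omega>)" by (intro Bochner_Integration.integrable_sum t(1))
      moreover have "(\<integral>\<omega>. (\<Sum>k<K. ?t k \<omega>) \<partial>M) = (\<Sum>k<K. ?e k)"
        unfolding t(2)[symmetric] by (rule Bochner_Integration.integral_sum) (rule t(1))
      ultimately show ?thesis
        unfolding player_bound_def using noise_sum_integrable by (simp add: prob_space del: Bochner_Integration.integral_sum)
    qed
    also have "\<dots> \<le> 2 * R\<^sup>2 + (\<Sum>k<K. ?u k) + R * (1 + (\<upsilon> i)\<^sup>2 * (ca\<^sup>2 * S))"
    proof -
      have "(\<Sum>k<K. (\<alpha> i k)\<^sup>2) \<le> (\<Sum>k<K. ca\<^sup>2 * (\<gamma> k)\<^sup>2)" by (intro sum_mono \<alpha>2)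
      also have "\<dots> \<le> ca\<^sup>2 * S" unfolding sum_distrib_left[symmetric] by (intro mult_left_mono S) simp
      finally have "(\<upsilon> i)\<^sup>2 * (\<Sum>k<K. (\<alpha> i k)\<^sup>2) \<le> (\<upsilon> i)\<^sup>2 * (ca\<^sup>2 * S)" by (intro mult_left_mono) auto
      then have noise: "(\<integral>\<omega>. norm (\<Sum>k<K. \<alpha> i k *\<^sub>R \<zeta> i k \<omega>) \<partial>M) \<le> 1 + (\<upsilon> i)\<^sup>2 * (ca\<^sup>2 * S)"
        using noise_sum_le[of i K] by linarith
      have "(\<Sum>k<K. ?e k) \<le> (\<Sum>k<K. ?u k)" by (rule sum_mono) (rule e_le)
      from add_mono[OF add_mono[OF order_refl this] mult_left_mono[OF noise less_imp_le[OF R]]]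
      show ?thesis .
    qed
    also have "(\<Sum>k<K. ?u k) = (\<Sum>k<K. \<alpha>_max k - \<alpha> i k) * (2 * R * C)
        + 2 * R * L * ca * (\<Sum>k<K. \<gamma> k * (\<integral>\<omega>. dis k \<omega> \<partial>M))
        + 2 * R\<^sup>2 * ca * cd * (\<Sum>k<K. (real k + 1) powr (- (a + b))) + q * (\<Sum>k<K. (\<gamma> k)\<^sup>2)"
      by (simp only: sum.distrib sum_distrib_left[symmetric] sum_distrib_right[symmetric])
    also have "\<dots> \<le> cl * (2 * R * C) + 2 * R * L * ca * cD
        + 2 * R\<^sup>2 * ca * cd * (real K powr (1 - (a + b)) / (1 - (a + b))) + q * S"
      using R C L ca cd q cl cD S exponents
      by (intro add_mono mult_left_mono mult_right_mono sum_powr_neg_le) auto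
    finally show ?thesis by (simp add: c0_def c1_def algebra_simps)
  qed
  \<comment> \<open>Absolute values avoid tracking the signs of \<open>cl\<close> and
    \<open>cD\<close>.\<close>
  moreover have "c0 + c1 * p \<le> (\<bar>c0\<bar> + \<bar>c1\<bar>) * (1 + p)" if "0 \<le> p" for p :: real
  proof -
    have "c0 \<le> \<bar>c0\<bar>" "c1 * p \<le> \<bar>c1\<bar> * p" "0 \<le> \<bar>c0\<bar> * p" "0 \<le> \<bar>c1\<bar>"
      using that by (auto intro: mult_right_mono)
    then show ?thesis by (simp add: algebra_simps)
  qed
  ultimately have "(\<integral>\<omega>. player_bound R C L i K \<omega> \<partial>M) \<le> (\<bar>c0\<bar> + \<bar>c1\<bar>) * (1 + real K powr (1 - (a + b)))" for K
    by (meson order_trans powr_ge_zero)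
  then show thesis using int by (intro that[of "\<bar>c0\<bar> + \<bar>c1\<bar>"]) auto
qed

lemma expected_gap_bound:
  obtains c where "0 < c"
    "\<And>K. integrable M (\<lambda>\<omega>. gap XX \<phi> ((\<Sum>p<K. \<alpha>_max p *\<^sub>R x p \<omega>) /\<^sub>R (\<Sum>p<K. \<alpha>_max p)))"
    "\<And>K. 1 \<le> K \<Longrightarrow>
      (\<integral>\<omega>. gap XX \<phi> ((\<Sum>p<K. \<alpha>_max p *\<^sub>R x p \<omega>) /\<^sub>R (\<Sum>p<K. \<alpha>_max p)) \<partial>M)
        \<le> c * (real K powr (- b) + real K powr (a - 1))"
proof (rule F_dynamics_bounded)
  fix C L
  assume C: "0 < C" and L: "0 < L"
    and F1: "\<And>i k \<omega>. \<omega> \<in> space M \<Longrightarrow> norm (F i (xi i k \<omega>) (real CARD('n) *\<^sub>R v_hat k i \<omega>)) \<le> C"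
    and F2: "\<And>i y. y \<in> XX \<Longrightarrow> norm (F i (player_part own i y) (\<sigma> y)) \<le> C"
    and F3: "\<And>i k \<omega>. \<omega> \<in> space M \<Longrightarrow> norm (F i (xi i k \<omega>) (real CARD('n) *\<^sub>R v_hat k i \<omega>)
       - F i (xi i k \<omega>) (\<sigma> (x k \<omega>))) \<le> L * dis k \<omega>"
  obtain R where R: "0 < R" "\<And>i u. u \<in> X i \<Longrightarrow> norm u \<le> R" using radius by blast
  define S where "S K = (\<Sum>p<K. \<alpha>_max p)" for K
  define xa where "xa K \<omega> = (\<Sum>p<K. \<alpha>_max p *\<^sub>R x p \<omega>) /\<^sub>R S K" for K \<omega>
  let ?B = "player_bound R C L"

  have le_max: "\<alpha> i k \<le> \<alpha>_max k" for i k by simp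
  have max_pos: "0 < \<alpha>_max k" for k using \<alpha>_pos[of undefined k] le_max[of undefined k] by linarith

  have XX_norm: "norm y \<le> real CARD('n) * R" if "y \<in> XX" for y
  proof -
    have "norm (\<Sum>i\<in>UNIV. player_part own i y) \<le> (\<Sum>i\<in>(UNIV :: 'n set). R)"
      by (rule sum_norm_le) (use that R(2) in \<open>auto simp: XX_def\<close>)
    then show ?thesis by (simp add: sum_player_part)
  qed
  have \<phi>_norm: "norm (\<phi> y) \<le> real CARD('n) * C" if "y \<in> XX" for y
  proof -
    have "norm (\<phi> y) \<le> (\<Sum>i\<in>(UNIV :: 'n set). C)"
      unfolding \<phi>_def by (rule sum_norm_le) (rule F2[OF that])
    then show ?thesis by simp
  qed

  \<comment> \<open>\<open>K = 0\<close> is included: the total weight is then zero, its inverse is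
    zero by convention, and the average is the origin. The bounds on \<open>gap\<close> hold at
    every point, so this case needs no exception.\<close>
  have int: "integrable M (\<lambda>\<omega>. gap XX \<phi> (xa K \<omega>))" for K
  proof (rule integrable_const_bound)
    have "continuous_on UNIV (gap XX \<phi>)"
      by (rule lipschitz_on_continuous_on[OF gap_bounds(2)[OF XX_nonempty XX_norm \<phi>_norm]])
    moreover have "(\<lambda>\<omega>. xa K \<omega>) \<in> borel_measurable M" unfolding xa_def by measurable
    ultimately show "(\<lambda>\<omega>. gap XX \<phi> (xa K \<omega>)) \<in> borel_measurable M"
      by (rule measurable_compose[OF _ borel_measurable_continuous_onI, rotated])
    show "AE \<omega> in M. norm (gap XX \<phi> (xa K \<omega>)) \<le> real CARD('n) * C *
        ((\<Sum>p<K. \<alpha>_max p * (real CARD('n) * R)) / S K + real CARD('n) * R)"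
    proof (rule AE_I2)
      fix \<omega> assume \<omega>: "\<omega> \<in> space M"
      have "norm (\<Sum>p<K. \<alpha>_max p *\<^sub>R x p \<omega>) \<le> (\<Sum>p<K. \<alpha>_max p * (real CARD('n) * R))"
      proof (rule sum_norm_le)
        fix p
        show "norm (\<alpha>_max p *\<^sub>R x p \<omega>) \<le> \<alpha>_max p * (real CARD('n) * R)"
          using mult_left_mono[OF XX_norm[OF x_in_XX[OF \<omega>]] less_imp_le[OF max_pos], of p p] max_pos[of p] by simp
      qed
      moreover have "0 \<le> S K" unfolding S_def by (intro sum_nonneg less_imp_le max_pos)
      ultimately have "norm (xa K \<omega>) \<le> (\<Sum>p<K. \<alpha>_max p * (real CARD('n) * R)) / S K"
        by (simp add: xa_def divide_inverse mult.commute mult_left_mono)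
      then have "real CARD('n) * C * (norm (xa K \<omega>) + real CARD('n) * R) \<le> real CARD('n) * C *
        ((\<Sum>p<K. \<alpha>_max p * (real CARD('n) * R)) / S K + real CARD('n) * R)"
        using C by (intro mult_left_mono add_right_mono) auto
      with gap_bounds(1)[OF XX_nonempty XX_norm \<phi>_norm, where x = "xa K \<omega>"]
      show "norm (gap XX \<phi> (xa K \<omega>)) \<le> real CARD('n) * C *
        ((\<Sum>p<K. \<alpha>_max p * (real CARD('n) * R)) / S K + real CARD('n) * R)"
        unfolding real_norm_def by (rule order_trans)
    qed
  qed

  \<comment> \<open>Each \<open>F i\<close> lies in its own block, so the pairing splits into the
    players' pairings.\<close>
  have \<phi>_inner: "\<phi> y \<bullet> w = (\<Sum>i\<in>UNIV. F i (player_part own i y) (\<sigma> y) \<bullet> player_part own i w)" if "y \<in> XX" for y w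
    unfolding \<phi>_def inner_sum_left
    by (intro sum.cong refl inner_player_part[symmetric] F_block) (use that in \<open>simp add: XX_def\<close>)

  have path: "S K * gap XX \<phi> (xa K \<omega>) \<le> (\<Sum>i\<in>UNIV. ?B i K \<omega>)" if K: "1 \<le> K" and \<omega>: "\<omega> \<in> space M" for K \<omega>
  proof -
    have SK: "0 < S K" unfolding S_def
      by (rule sum_pos2[of _ 0]) (use K max_pos in \<open>auto intro: less_imp_le\<close>)
    have "gap XX \<phi> (xa K \<omega>) \<le> (\<Sum>i\<in>UNIV. ?B i K \<omega>) / S K"
    proof (rule gap_le[OF XX_nonempty])
      fix y assume y: "y \<in> XX"
      have scaled: "S K *\<^sub>R (xa K \<omega> - y) = (\<Sum>p<K. \<alpha>_max p *\<^sub>R (x p \<omega> - y))"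
        using SK by (simp add: xa_def scaleR_diff_right sum_subtractf scaleR_left.sum[symmetric] S_def[symmetric])
      have "S K * ((xa K \<omega> - y) \<bullet> \<phi> y) = (S K *\<^sub>R (xa K \<omega> - y)) \<bullet> \<phi> y" by simp
      also have "\<dots> = (\<Sum>p<K. \<alpha>_max p * ((x p \<omega> - y) \<bullet> \<phi> y))"
        unfolding scaled inner_sum_left inner_scaleR_left ..
      \<comment> \<open>Monotonicity moves \<phi> from the fixed point y, where averaging is linear,
        to the iterates, where descent controls it.\<close>
      also have "\<dots> \<le> (\<Sum>p<K. \<alpha>_max p * (\<phi> (x p \<omega>) \<bullet> (x p \<omega> - y)))"
      proof (intro sum_mono mult_left_mono less_imp_le[OF max_pos])
        fix p
        show "(x p \<omega> - y) \<bullet> \<phi> y \<le> \<phi> (x p \<omega>) \<bullet> (x p \<omega> - y)"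
          using \<phi>_monotone[OF x_in_XX[OF \<omega>] y, of p]
          unfolding inner_commute[of "x p \<omega> - y" "\<phi> y"] inner_diff_left[of "\<phi> (x p \<omega>)"] by linarith
      qed
      also have "\<dots> = (\<Sum>p<K. \<Sum>i\<in>UNIV. \<alpha>_max p * (F i (xi i p \<omega>) (\<sigma> (x p \<omega>)) \<bullet> (xi i p \<omega> - player_part own i y)))"
        by (intro sum.cong refl)
           (simp add: \<phi>_inner[OF x_in_XX[OF \<omega>]] sum_distrib_left
              linear_diff[OF bounded_linear.linear[OF bounded_linear_player_part]])
      also have "\<dots> = (\<Sum>i\<in>UNIV. \<Sum>p<K. \<alpha>_max p * (F i (xi i p \<omega>) (\<sigma> (x p \<omega>)) \<bullet> (xi i p \<omega> - player_part own i y)))"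
        by (rule sum.swap)
      also have "\<dots> \<le> (\<Sum>i\<in>UNIV. ?B i K \<omega>)"
      proof (rule sum_mono)
        fix i
        have "player_part own i y \<in> X i" using y by (simp add: XX_def)
        then show "(\<Sum>p<K. \<alpha>_max p * (F i (xi i p \<omega>) (\<sigma> (x p \<omega>)) \<bullet> (xi i p \<omega> - player_part own i y))) \<le> ?B i K \<omega>"
          by (rule player_gap_le[OF \<omega> _ R(2) F1[OF \<omega>] F2[OF x_in_XX[OF \<omega>]] F3[OF \<omega>]])
      qed
      finally show "(xa K \<omega> - y) \<bullet> \<phi> y \<le> (\<Sum>i\<in>UNIV. ?B i K \<omega>) / S K"
        using SK by (simp add: pos_le_divide_eq mult.commute)
    qed
    then show ?thesis using SK by (simp add: pos_le_divide_eq mult.commute)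
  qed

  have "\<exists>c. 0 \<le> c \<and> (\<forall>K. integrable M (?B i K)) \<and>
      (\<forall>K\<ge>1. (\<integral>\<omega>. ?B i K \<omega> \<partial>M) \<le> c * (1 + real K powr (1 - (a + b))))" for i
    by (rule player_bound_expectation[OF R(1) C L, of i]) blast
  then have "\<exists>c. \<forall>i. 0 \<le> c i \<and> (\<forall>K. integrable M (?B i K)) \<and>
      (\<forall>K\<ge>1. (\<integral>\<omega>. ?B i K \<omega> \<partial>M) \<le> c i * (1 + real K powr (1 - (a + b))))"
    by (intro choice allI)
  then obtain c where "\<forall>i. 0 \<le> c i \<and> (\<forall>K. integrable M (?B i K)) \<and>
      (\<forall>K\<ge>1. (\<integral>\<omega>. ?B i K \<omega> \<partial>M) \<le> c i * (1 + real K powr (1 - (a + b))))"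
    by (rule exE)
  then have c: "0 \<le> c i" "integrable M (?B i K)"
    "1 \<le> K \<Longrightarrow> (\<integral>\<omega>. ?B i K \<omega> \<partial>M) \<le> c i * (1 + real K powr (1 - (a + b)))" for i K
    by blast+
  define c' where "c' = 1 + (\<Sum>i\<in>UNIV. c i)"
  have c': "0 < c'" using c(1) by (simp add: c'_def add_pos_nonneg sum_nonneg)
  \<comment> \<open>Any single player's steps bound the total weight from below;
    \<open>undefined\<close> is an arbitrary player.\<close>
  define s where "s = (1 + lam undefined) powr (- a)"
  have s: "0 < s" using lam_pos[of undefined] by (simp add: s_def)

  have "(\<integral>\<omega>. gap XX \<phi> (xa K \<omega>) \<partial>M) \<le> c' / s * (real K powr (- b) + real K powr (a - 1))" if K: "1 \<le> K" for K
  proof -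
    define r where "r = real K powr (- b) + real K powr (a - 1)"
    have S_ge: "s * real K powr (1 - a) \<le> S K"
    proof -
      have "s * real K powr (1 - a) \<le> (\<Sum>k<K. \<alpha> undefined k)"
        unfolding s_def \<alpha>_def using lam_pos exponents K by (intro sum_powr_neg_ge) auto
      also have "\<dots> \<le> S K" unfolding S_def by (intro sum_mono le_max)
      finally show ?thesis .
    qed
    have sK: "0 < s * real K powr (1 - a)" using s K by simp
    have "S K * (\<integral>\<omega>. gap XX \<phi> (xa K \<omega>) \<partial>M) = (\<integral>\<omega>. S K * gap XX \<phi> (xa K \<omega>) \<partial>M)" by simp
    also have "\<dots> \<le> (\<integral>\<omega>. (\<Sum>i\<in>UNIV. ?B i K \<omega>) \<partial>M)"
      by (intro integral_mono path[OF K]) (use int c(2) in auto)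
    also have "\<dots> = (\<Sum>i\<in>UNIV. \<integral>\<omega>. ?B i K \<omega> \<partial>M)"
      by (rule Bochner_Integration.integral_sum) (rule c(2))
    also have "\<dots> \<le> (\<Sum>i\<in>UNIV. c i * (1 + real K powr (1 - (a + b))))"
      by (intro sum_mono c(3) K)
    also have "\<dots> \<le> c' * (1 + real K powr (1 - (a + b)))"
      unfolding c'_def by (simp add: sum_distrib_right[symmetric] distrib_right add_nonneg_nonneg)
    \<comment> \<open>Factoring out the order K^(1-a) of the total weight exhibits the two
      rates.\<close>
    also have "1 + real K powr (1 - (a + b)) = real K powr (1 - a) * r"
      using K by (simp add: r_def distrib_left powr_add[symmetric] diff_diff_eq)
    finally have main: "S K * (\<integral>\<omega>. gap XX \<phi> (xa K \<omega>) \<partial>M) \<le> c' * (real K powr (1 - a) * r)" .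
    \<comment> \<open>The lower bound on the total weight can be used only against a nonnegative
      expectation; a negative one satisfies the claim at once. The case split takes the place of
      showing that the average lies in \<open>XX\<close>.\<close>
    show ?thesis
    proof (cases "0 \<le> (\<integral>\<omega>. gap XX \<phi> (xa K \<omega>) \<partial>M)")
      case True
      then have "s * real K powr (1 - a) * (\<integral>\<omega>. gap XX \<phi> (xa K \<omega>) \<partial>M) \<le> c' * (real K powr (1 - a) * r)"
        using mult_right_mono[OF S_ge True] main by linarith
      also have "\<dots> = s * real K powr (1 - a) * (c' / s * r)" using s by simp
      finally show ?thesis using sK by (simp only: mult_le_cancel_left_pos r_def)
    next
      case False
      have "0 \<le> c' / s * r" using c' s by (simp add: r_def)
      with False show ?thesis unfolding r_def by linarith
    qed
  qed
  note bound = this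
  show thesis
  proof (rule that[of "c' / s"])
    show "0 < c' / s" using c' s by simp
  qed (use int bound in \<open>simp_all only: xa_def S_def\<close>)
qed

end

section \<open>Instantiation for the game and the explicit constants\<close>

theorem theorem2:
  fixes M :: "'w measure"
    and own :: "'m::finite \<Rightarrow> 'n::finite"
    and X :: "'n \<Rightarrow> (real^'m) set"
    and h :: "'n \<Rightarrow> real^'m \<Rightarrow> real^'m"
    and d :: "'n \<Rightarrow> nat"
    and \<xi> :: "'n \<Rightarrow> 'w \<Rightarrow> nat \<Rightarrow> real"
    and \<psi> :: "'n \<Rightarrow> real^'m \<Rightarrow> real^'m \<Rightarrow> (nat \<Rightarrow> real) \<Rightarrow> real"
    and Lh \<upsilon> lam \<delta> :: "'n \<Rightarrow> real"
    and E :: "nat \<Rightarrow> ('n \<times> 'n) set"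
    and W :: "nat \<Rightarrow> real^'n^'n"
    and wmin a b :: real
    and P :: nat
    and x :: "nat \<Rightarrow> 'w \<Rightarrow> real^'m"
    and v :: "nat \<Rightarrow> 'n \<Rightarrow> 'w \<Rightarrow> real^'m"
    and \<xi>s :: "'n \<Rightarrow> nat \<Rightarrow> 'w \<Rightarrow> nat \<Rightarrow> real"
  fixes N :: nat
    and XX :: "(real^'m) set"
    and f :: "'n \<Rightarrow> real^'m \<Rightarrow> real^'m \<Rightarrow> real"
    and \<sigma> :: "real^'m \<Rightarrow> real^'m"
    and \<sigma>_minus :: "'n \<Rightarrow> real^'m \<Rightarrow> real^'m"
    and F :: "'n \<Rightarrow> real^'m \<Rightarrow> real^'m \<Rightarrow> real^'m"
    and q :: "'n \<Rightarrow> real^'m \<Rightarrow> real^'m \<Rightarrow> (nat \<Rightarrow> real) \<Rightarrow> real^'m"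
    and \<phi> :: "real^'m \<Rightarrow> real^'m"
    and \<alpha> \<eta> :: "'n \<Rightarrow> nat \<Rightarrow> real"
    and v_hat :: "nat \<Rightarrow> 'n \<Rightarrow> 'w \<Rightarrow> real^'m"
    and \<zeta> :: "'n \<Rightarrow> nat \<Rightarrow> 'w \<Rightarrow> real^'m"
    and \<alpha>_max :: "nat \<Rightarrow> real"
    and x_avg :: "nat \<Rightarrow> 'w \<Rightarrow> real^'m"
    and \<beta> :: real
  defines "N \<equiv> CARD('n)"
    and "XX \<equiv> {y. \<forall>i. player_part own i y \<in> X i}"
    and "f \<equiv> (\<lambda>i u s. \<integral>\<omega>. \<psi> i u s (\<xi> i \<omega>) \<partial>M)"
    and "\<sigma> \<equiv> (\<lambda>y. \<Sum>j\<in>UNIV. h j (player_part own j y))"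
    and "\<sigma>_minus \<equiv> (\<lambda>i y. \<Sum>j\<in>UNIV - {i}. h j (player_part own j y))"
    and "F \<equiv> (\<lambda>i. aggr_grad (block own i) (h i) (f i))"
    and "q \<equiv> (\<lambda>i u z s. aggr_grad (block own i) (h i) (\<lambda>u' z'. \<psi> i u' z' s) u z)"
    and "\<phi> \<equiv> (\<lambda>y. \<Sum>i\<in>UNIV. F i (player_part own i y) (\<sigma> y))"
    and "\<alpha> \<equiv> (\<lambda>i k. (real k + lam i) powr (-a))"
    and "\<eta> \<equiv> (\<lambda>i k. (real k + \<delta> i) powr (-b))"
    and "v_hat \<equiv> (\<lambda>k i \<omega>. \<Sum>j\<in>{j. (j, i) \<in> E k}. (W k $ i $ j) *\<^sub>R v k j \<omega>)"
    and "\<zeta> \<equiv> (\<lambda>i k \<omega>. q i (player_part own i (x k \<omega>)) (real N *\<^sub>R v_hat k i \<omega>) (\<xi>s i k \<omega>)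
                       - F i (player_part own i (x k \<omega>)) (real N *\<^sub>R v_hat k i \<omega>))"
    and "\<alpha>_max \<equiv> (\<lambda>k. Max (range (\<lambda>i. \<alpha> i k)))"
    and "x_avg \<equiv> (\<lambda>K \<omega>. (\<Sum>p<K. \<alpha>_max p *\<^sub>R x p \<omega>) /\<^sub>R (\<Sum>p<K. \<alpha>_max p))"
    and "\<beta> \<equiv> (1 - wmin / (4 * (real N)\<^sup>2)) powr (1 / real P)"
  assumes "prob_space M"
    and \<xi>_rv: "\<And>i. \<xi> i \<in> M \<rightarrow>\<^sub>M borel_vec (d i)"
    and h_C1: "\<And>i. cont_diff_on (block own i) (block own i) (h i)"
    and X_sets: "\<And>i. X i \<subseteq> block own i \<and> closed (X i) \<and> compact (X i) \<and> convex (X i)"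
    and f_convex: "\<And>i y. (\<forall>j. j \<noteq> i \<longrightarrow> player_part own j y \<in> X j) \<Longrightarrow>
           convex_on (X i) (\<lambda>u. f i u (h i u + \<sigma>_minus i y))"
    and f_C1: "\<And>i. \<exists>U. openin (top_of_set (block own i \<times> UNIV)) U \<and> X i \<times> UNIV \<subseteq> U \<and>
           (\<forall>(u, s)\<in>U. integrable M (\<lambda>\<omega>. \<psi> i u s (\<xi> i \<omega>))) \<and>
           cont_diff_on (block own i \<times> UNIV) U (\<lambda>(u, s). f i u s)"
    and \<phi>_lipschitz: "\<exists>L. L-lipschitz_on XX \<phi>"
    and \<phi>_monotone: "\<And>y y'. y \<in> XX \<Longrightarrow> y' \<in> XX \<Longrightarrow> (\<phi> y - \<phi> y') \<bullet> (y - y') \<ge> 0"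
    and h_lipschitz: "\<And>i. (Lh i)-lipschitz_on (X i) (h i)"
    and F_lipschitz: "\<And>i c. c > 0 \<Longrightarrow> \<exists>Lf. \<forall>u\<in>X i. \<forall>z1 z2. norm z1 \<le> c \<and> norm z2 \<le> c \<longrightarrow>
           norm (F i u z1 - F i u z2) \<le> Lf * norm (z1 - z2)"
    and \<psi>_differentiable: "\<And>i. \<exists>C. openin (top_of_set (block own i)) C \<and> X i \<subseteq> C \<and>
           (\<forall>s\<in>space (borel_vec (d i)). \<forall>p\<in>C \<times> UNIV.
             (\<lambda>(u, z). \<psi> i u z s) differentiable (at p within block own i \<times> UNIV))"
    and \<upsilon>_pos: "\<And>i. \<upsilon> i > 0"
    and q_unbiased: "\<And>i u z. u \<in> X i \<Longrightarrow>
           integrable M (\<lambda>\<omega>. q i u z (\<xi> i \<omega>)) \<and> (\<integral>\<omega>. q i u z (\<xi> i \<omega>) \<partial>M) = F i u z"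
    and q_variance: "\<And>i u z. u \<in> X i \<Longrightarrow>
           integrable M (\<lambda>\<omega>. (norm (q i u z (\<xi> i \<omega>) - F i u z))\<^sup>2) \<and>
           (\<integral>\<omega>. (norm (q i u z (\<xi> i \<omega>) - F i u z))\<^sup>2 \<partial>M) \<le> (\<upsilon> i)\<^sup>2"
    and self_loops: "\<And>k i. (i, i) \<in> E k"
    and W_support: "\<And>k i j. if (j, i) \<in> E k then W k $ i $ j > 0 else W k $ i $ j = 0"
    and W_stochastic: "\<And>k. doubly_stochastic (W k)"
    and wmin: "0 < wmin" "wmin < 1" "\<And>k i j. (j, i) \<in> E k \<Longrightarrow> W k $ i $ j \<ge> wmin"
    and P_pos: "P > 0"
    and connected: "\<And>k. strongly_connected
           (with_proj \<lparr>pverts = UNIV, parcs = (\<Union>l\<in>{1..P}. E (k + l))\<rparr>)"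
    and lam_pos: "\<And>i. lam i > 0"
    and \<delta>_pos: "\<And>i. \<delta> i > 0"
    and exponents: "1 / 2 < a" "a < 1" "a > b" "b > 0" "a + b < 1"
    and x_0: "x 0 \<in> borel_measurable M" "\<And>i \<omega>. \<omega> \<in> space M \<Longrightarrow> player_part own i (x 0 \<omega>) \<in> X i"
    and v_0: "\<And>i \<omega>. \<omega> \<in> space M \<Longrightarrow> v 0 i \<omega> = h i (player_part own i (x 0 \<omega>))"
    and x_step: "\<And>k i \<omega>. \<omega> \<in> space M \<Longrightarrow> player_part own i (x (Suc k) \<omega>) =
           closest_point (X i) (player_part own i (x k \<omega>) - \<alpha> i k *\<^sub>R
             (q i (player_part own i (x k \<omega>)) (real N *\<^sub>R v_hat k i \<omega>) (\<xi>s i k \<omega>)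
              + \<eta> i k *\<^sub>R player_part own i (x k \<omega>)))"
    and v_step: "\<And>k i \<omega>. \<omega> \<in> space M \<Longrightarrow> v (Suc k) i \<omega> =
           v_hat k i \<omega> + h i (player_part own i (x (Suc k) \<omega>)) - h i (player_part own i (x k \<omega>))"
    and \<xi>s_rv: "\<And>i k. \<xi>s i k \<in> M \<rightarrow>\<^sub>M borel_vec (d i)"
    and \<xi>s_law: "\<And>i k. distr M (borel_vec (d i)) (\<xi>s i k) = distr M (borel_vec (d i)) (\<xi> i)"
    and \<zeta>_rv: "\<And>i k. \<zeta> i k \<in> borel_measurable M"
    and \<zeta>_mean: "\<And>i k c. AE \<omega> in M.
           real_cond_exp M (history M (x 0) \<zeta> k) (\<lambda>\<omega>'. \<zeta> i k \<omega>' $ c) \<omega> = 0"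
    and \<zeta>_variance: "\<And>i k. AE \<omega> in M.
           nn_cond_exp M (history M (x 0) \<zeta> k) (\<lambda>\<omega>'. ennreal ((norm (\<zeta> i k \<omega>'))\<^sup>2)) \<omega>
             \<le> ennreal ((\<upsilon> i)\<^sup>2)"
  shows "\<exists>Cg1 > 0. \<exists>Cg2 > 0. \<forall>K::nat. K \<ge> 1 \<longrightarrow>
           integrable M (\<lambda>\<omega>. gap XX \<phi> (x_avg K \<omega>)) \<and>
           (\<integral>\<omega>. gap XX \<phi> (x_avg K \<omega>) \<partial>M)
             \<le> Cg1 * real N * real K powr (-b)
               + Cg2 * real N ^ 5 * \<beta> powi (-1) * (1 - \<beta>) powi (-2) * real K powr (a - 1)"
proof -
  interpret prob_space M by fact
  have N: "real N = real CARD('n)" by (simp add: N_def)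
  have W0: "W k $ i $ j = 0" if "(j, i) \<notin> E k" for k i j
    using W_support[where k = k and i = i and j = j] that by simp
  \<comment> \<open>Weights vanish off the edges, so the sum over neighbours is a full matrix
    product.\<close>
  have v_hat: "v_hat k i \<omega> = (\<Sum>j\<in>UNIV. (W k $ i $ j) *\<^sub>R v k j \<omega>)" for k i \<omega>
    unfolding v_hat_def by (rule sum.mono_neutral_left) (use W0 in auto)
  have F: "continuous_on (X i \<times> UNIV) (\<lambda>(u, z). F i u z)"
    "\<And>u z. u \<in> X i \<Longrightarrow> F i u z \<in> block own i" for i
  proof -
    obtain U where U: "openin (top_of_set (block own i \<times> UNIV)) U" "X i \<times> UNIV \<subseteq> U"
      "cont_diff_on (block own i \<times> UNIV) U (\<lambda>(u, s). f i u s)"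
      using f_C1[of i] by blast
    have Xi: "X i \<subseteq> block own i" using X_sets by blast
    note aggr = continuous_on_aggr_grad[OF h_C1 U(3) Xi U(2)]
    show "continuous_on (X i \<times> UNIV) (\<lambda>(u, z). F i u z)"
      unfolding F_def by (rule aggr(1))
    show "F i u z \<in> block own i" if "u \<in> X i" for u z
      unfolding F_def by (rule aggr(2)[OF that])
  qed
  \<comment> \<open>By definition of \<zeta>, the sampled gradient is \<open>F\<close> plus
    \<zeta>.\<close>
  have x_step': "player_part own i (x (Suc k) \<omega>) =
      closest_point (X i) (player_part own i (x k \<omega>) - \<alpha> i k *\<^sub>R
        (F i (player_part own i (x k \<omega>)) (real CARD('n) *\<^sub>R v_hat k i \<omega>) + \<zeta> i k \<omega>
          + \<eta> i k *\<^sub>R player_part own i (x k \<omega>)))" if "\<omega> \<in> space M" for i k \<omega>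
    using x_step[OF that, of i k] by (simp add: \<zeta>_def N)
  have X: "compact (X i)" "convex (X i)" for i using X_sets by blast+
  have v_hat_eq: "v_hat \<equiv> (\<lambda>k i \<omega>. \<Sum>j\<in>UNIV. (W k $ i $ j) *\<^sub>R v k j \<omega>)"
    by (rule eq_reflection) (simp add: fun_eq_iff v_hat)
  interpret dyn: tracking_dynamics M own X h F Lh \<upsilon> lam \<delta> E W wmin a b P x v \<zeta> \<alpha> \<eta> v_hat \<sigma> \<phi> XX
    by unfold_locales
       (fact X h_lipschitz F F_lipschitz \<phi>_monotone[unfolded \<phi>_def \<sigma>_def XX_def]
          self_loops W_stochastic wmin connected lam_pos \<delta>_pos exponents x_0 v_0
          x_step'[unfolded \<alpha>_def \<eta>_def v_hat] v_step[unfolded v_hat] \<zeta>_rv \<zeta>_mean \<zeta>_variance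
          \<alpha>_def \<eta>_def v_hat_eq \<sigma>_def \<phi>_def XX_def)+
  obtain c where c: "0 < c" "\<And>K. integrable M (\<lambda>\<omega>. gap XX \<phi> (x_avg K \<omega>))"
    "\<And>K. 1 \<le> K \<Longrightarrow> (\<integral>\<omega>. gap XX \<phi> (x_avg K \<omega>) \<partial>M) \<le> c * (real K powr (- b) + real K powr (a - 1))"
    unfolding x_avg_def \<alpha>_max_def by (rule dyn.expected_gap_bound) blast
  have N1: "1 \<le> real N" by (simp add: N_def Suc_le_eq)
  have small: "wmin / (4 * (real N)\<^sup>2) < 1" "0 < wmin / (4 * (real N)\<^sup>2)"
  proof -
    have "1 \<le> (real N)\<^sup>2" using N1 by (simp add: one_le_power)
    then have pos: "0 < 4 * (real N)\<^sup>2" and "wmin < 4 * (real N)\<^sup>2" using wmin(2) by linarith+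
    then show "wmin / (4 * (real N)\<^sup>2) < 1" by (simp add: divide_less_eq)
    show "0 < wmin / (4 * (real N)\<^sup>2)" using wmin(1) pos by (rule divide_pos_pos)
  qed
  \<comment> \<open>Strictness on both sides matters: at \<beta> = 0 or \<beta> = 1 one of the
    inverse powers would be zero by convention and the second term of the bound would
    vanish.\<close>
  have \<beta>: "0 < \<beta>" "\<beta> < 1"
  proof -
    show "0 < \<beta>" unfolding \<beta>_def powr_gt_zero using small(1) by linarith
    have "\<beta> < 1 powr (1 / real P)"
      unfolding \<beta>_def using small P_pos by (intro powr_less_mono2) auto
    then show "\<beta> < 1" by simp
  qed
  \<comment> \<open>The explicit factor is a fixed positive number, so dividing by it produces the
    second constant; for the first, N \<ge> 1 suffices.\<close>
  define w where "w = real N ^ 5 * \<beta> powi (-1) * (1 - \<beta>) powi (-2)"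
  have w: "0 < w" using N1 \<beta> by (simp add: w_def zero_less_power_int)
  have cw: "0 < c / w" using c(1) w by simp
  show ?thesis
  proof (rule exI[of _ c], rule conjI[OF c(1)], rule exI[of _ "c / w"], rule conjI[OF cw],
      intro allI impI conjI)
    fix K :: nat assume K: "1 \<le> K"
    show "integrable M (\<lambda>\<omega>. gap XX \<phi> (x_avg K \<omega>))" by (rule c(2))
    have "(\<integral>\<omega>. gap XX \<phi> (x_avg K \<omega>) \<partial>M) \<le> c * 1 * real K powr (- b) + c * real K powr (a - 1)"
      using c(3)[OF K] by (simp add: distrib_left)
    also have "\<dots> \<le> c * real N * real K powr (- b) + c / w * w * real K powr (a - 1)"
      using c(1) N1 w by (intro add_mono mult_right_mono mult_left_mono) auto
    finally show "(\<integral>\<omega>. gap XX \<phi> (x_avg K \<omega>) \<partial>M) \<le> c * real N * real K powr (- b)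
        + c / w * real N ^ 5 * \<beta> powi (-1) * (1 - \<beta>) powi (-2) * real K powr (a - 1)"
      by (simp only: w_def mult.assoc)
  qed
qed

end
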